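(* Let $\{X_n\}_{n=0}^\infty$ be a random walk in a deterministic "have your cookie and eat it" environment $\omega=\{\omega(x)\}_{x\in\mathbb{Z}}$, where $\omega(x)\in[\frac12,1)$ for all $x\in\mathbb{Z}$. (i) Let $\omega(x)=p$ for all $x\in\mathbb{Z}$, where $p\in(\frac12,1)$. Then $P_1(T_0=\infty)=0$ if $p\le\frac23$, and $$\frac{3p-2}{p}\le P_1(T_0=\infty)\le\frac1p\,\frac{3p-2}{2p-1}\quad\text{if } p\in(\tfrac23,1).$$ In particular, the process is recurrent if $p\le\frac23$ and transient if $p>\frac23$. (ii) Let $\omega$ be periodic with period $N>1$, that is, $\omega(x+N)=\omega(x)$ for all $x\in\mathbb{Z}$. Then the process is recurrent if $\frac1N\sum_{x=1}^N\frac{\omega(x)}{1-\omega(x)}\le2$ and transient if $\frac1N\sum_{x=1}^N\frac{\omega(x)}{1-\omega(x)}>2$.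
   Context: Random walk in a "have your cookie and eat it" environment: given $\omega=\{\omega(x)\}_{x\in\mathbb{Z}}$ with $\omega(x)\in[\frac12,1)$, the process $\{X_n\}_{n\ge0}$ is the nearest-neighbor process on $\mathbb{Z}$ (each step is $\pm1$) such that, conditionally on $X_0,\dots,X_n$, the probability that $X_{n+1}=X_n+1$ equals $\omega(X_n)$ if the process has not previously jumped left from the site $X_n$ (i.e. there is no $k<n$ with $X_k=X_n$ and $X_{k+1}=X_n-1$), and equals $\frac12$ otherwise; with the complementary probability $X_{n+1}=X_n-1$. $P_x$ denotes the law of the process started from $X_0=x$ (with no cookie consumed at time $0$). $T_x=\inf\{n\ge0:X_n=x\}$ (with $\inf\emptyset=\infty$). The process is called recurrent if $P_y(X_n=x\ \text{i.o.})=1$ for all $x,y\in\mathbb{Z}$, and transient if $P_y(X_n=x\ \text{i.o.})=0$ for all $x,y\in\mathbb{Z}$. *)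

theory Defs
  imports "HOL-Probability.Probability"
begin

text \<open>A path is a function \<open>X :: nat \<Rightarrow> int\<close>, the environment a function \<open>\<omega> :: int \<Rightarrow> real\<close>.\<close>

definition jumped_left_before :: "(nat \<Rightarrow> int) \<Rightarrow> nat \<Rightarrow> bool" where
  "jumped_left_before X n \<longleftrightarrow> (\<exists>k<n. X k = X n \<and> X (Suc k) = X n - 1)"

definition right_prob :: "(int \<Rightarrow> real) \<Rightarrow> (nat \<Rightarrow> int) \<Rightarrow> nat \<Rightarrow> real" where
  "right_prob \<omega> X n = (if jumped_left_before X n then 1/2 else \<omega> (X n))"

text \<open>
  The conditional law of \<open>X n\<close> given \<open>X 0, \<dots>, X (n - 1)\<close>; for \<open>n = 0\<close> it is the initial
  distribution. Only the values \<open>X k\<close> with \<open>k < n\<close> are inspected. Note that \<open>bernoulli_pmf\<close>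
  truncates its parameter to the unit interval, which is immaterial for environments with values
  in \<open>[1/2, 1)\<close>.
\<close>

primrec step_pmf :: "(int \<Rightarrow> real) \<Rightarrow> int \<Rightarrow> nat \<Rightarrow> (nat \<Rightarrow> int) \<Rightarrow> int pmf" where
  "step_pmf \<omega> x 0 X = return_pmf x"
| "step_pmf \<omega> x (Suc n) X =
     map_pmf (\<lambda>right. if right then X n + 1 else X n - 1) (bernoulli_pmf (right_prob \<omega> X n))"

text \<open>
  The law \<open>P\<^sub>x\<close> on path space: the Ionescu-Tulcea measure of these kernels. The characterising
  properties are \<open>measure_cookie_law_0\<close>, \<open>measure_cookie_law_right\<close> and
  \<open>measure_cookie_law_left\<close> below.
\<close>

definition cookie_law :: "(int \<Rightarrow> real) \<Rightarrow> int \<Rightarrow> (nat \<Rightarrow> int) measure" where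
  "cookie_law \<omega> x =
     projective_family.lim UNIV
       (Ionescu_Tulcea.CI (\<lambda>n X. measure_pmf (step_pmf \<omega> x n X)) (\<lambda>_. count_space UNIV))
       (\<lambda>_. count_space UNIV)"

definition hitting_time :: "int \<Rightarrow> (nat \<Rightarrow> int) \<Rightarrow> enat" where
  "hitting_time x X = Inf {enat n | n. X n = x}"

definition recurrent :: "(int \<Rightarrow> real) \<Rightarrow> bool" where
  "recurrent \<omega> \<longleftrightarrow> (\<forall>x y. \<P>(X in cookie_law \<omega> y. \<exists>\<^sub>\<infinity>n. X n = x) = 1)"

definition transient :: "(int \<Rightarrow> real) \<Rightarrow> bool" where
  "transient \<omega> \<longleftrightarrow> (\<forall>x y. \<P>(X in cookie_law \<omega> y. \<exists>\<^sub>\<infinity>n. X n = x) = 0)"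


subsection \<open>The law is well defined and has the prescribed transition probabilities\<close>

lemma right_prob_cong:
  assumes "\<And>k. k \<le> n \<Longrightarrow> X k = Y k"
  shows "right_prob \<omega> X n = right_prob \<omega> Y n"
proof -
  have "jumped_left_before X n = jumped_left_before Y n"
    unfolding jumped_left_before_def using assms by (auto simp: Suc_le_eq)
  then show ?thesis
    using assms by (simp add: right_prob_def)
qed

lemma step_pmf_cong:
  assumes "\<And>k. k < n \<Longrightarrow> X k = Y k"
  shows "step_pmf \<omega> x n X = step_pmf \<omega> x n Y"
  proof (cases n)
  case (Suc m)
  then have "right_prob \<omega> X m = right_prob \<omega> Y m" "X m = Y m"
    using assms by (auto intro!: right_prob_cong)
  then show ?thesis
    by (simp only: Suc step_pmf.simps)
qed simp

interpretation cookie: Ionescu_Tulcea "\<lambda>n X. measure_pmf (step_pmf \<omega> x n X)" "\<lambda>_. count_space UNIV"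
  for \<omega> x
proof
  show "(\<lambda>X. measure_pmf (step_pmf \<omega> x i X))
      \<in> measurable (PiM {0..<i} (\<lambda>_. count_space UNIV)) (subprob_algebra (count_space UNIV))" for i
    by (subst count_space_PiM_finite) (auto simp: measure_pmf_in_subprob_algebra)
qed

lemma cookie_law_eq: "cookie_law \<omega> x = cookie.PF.lim \<omega> x"
  by (simp add: cookie_law_def)

lemma sets_cookie_law [measurable_cong, simp]:
  "sets (cookie_law \<omega> x) = sets (PiM UNIV (\<lambda>_. count_space UNIV))"
  by (simp add: cookie_law_eq)

lemma space_cookie_law [simp]: "space (cookie_law \<omega> x) = UNIV"
  using sets_eq_imp_space_eq[OF sets_cookie_law] by (simp add: space_PiM)

lemma emeasure_cookie_law_cylinder:
  "emeasure (cookie_law \<omega> x) {X. \<forall>i<n. X i = h i} =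
   emeasure (cookie.C \<omega> x 0 n (\<lambda>_. undefined)) {restrict h {0..<n}}"
proof -
  let ?M = "\<lambda>_::nat. count_space (UNIV :: int set)"
  have A: "{restrict h {0..<n}} \<in> sets (PiM {0..<n} ?M)"
    by (subst count_space_PiM_finite) auto
  have "restrict X {0..<n} = restrict h {0..<n} \<longleftrightarrow> (\<forall>i<n. X i = h i)" for X
    by (metis atLeastLessThan_iff le0 restrict_apply' restrict_ext)
  then have "{X. \<forall>i<n. X i = h i} = prod_emb UNIV ?M {0..<n} {restrict h {0..<n}}"
    by (simp add: prod_emb_def vimage_def)
  moreover have "prod_emb {0..<n} ?M {0..<n} {restrict h {0..<n}} = {restrict h {0..<n}}"
    using A by (intro prod_emb_id) (auto dest: sets.sets_into_space simp: space_PiM)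
  ultimately show ?thesis
    using cookie.lim[OF _ A, of \<omega> x] cookie.emeasure_CI[OF subset_refl A, of \<omega> x]
    by (simp add: cookie_law_eq)
qed

lemma emeasure_C_Suc:
  "emeasure (cookie.C \<omega> x 0 (Suc n) (\<lambda>_. undefined)) {restrict h {0..<Suc n}} =
   emeasure (cookie.C \<omega> x 0 n (\<lambda>_. undefined)) {restrict h {0..<n}} * pmf (step_pmf \<omega> x n h) (h n)"
proof -
  let ?M = "\<lambda>_::nat. count_space (UNIV :: int set)"
  let ?C = "cookie.C \<omega> x 0 n (\<lambda>_. undefined)"
  have A: "{restrict h {0..<k}} \<in> sets (PiM {0..<k} ?M)" for k
    by (subst count_space_PiM_finite) auto
  have sp: "(\<lambda>_. undefined) \<in> space (PiM {0..<0} ?M)"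
    by (simp add: space_PiM)
  have setsC: "sets ?C = sets (PiM {0..<n} ?M)"
    using cookie.sets_C[OF sp, of \<omega> x n] by simp
  have spC: "space ?C = space (PiM {0..<n} ?M)"
    using setsC by (rule sets_eq_imp_space_eq)
  have ne: "space ?C \<noteq> {}"
    by (simp add: spC space_PiM PiE_eq_empty_iff)
  have "emeasure (cookie.C \<omega> x 0 (Suc n) (\<lambda>_. undefined)) {restrict h {0..<Suc n}} =
      (\<integral>\<^sup>+Y. emeasure (cookie.eP \<omega> x n Y) {restrict h {0..<Suc n}} \<partial>?C)"
    unfolding cookie.C.simps add_0
    by (rule emeasure_bind[OF ne _ A])
       (use cookie.measurable_eP[of \<omega> x n] in \<open>simp add: measurable_cong_sets[OF setsC refl]\<close>)
  also have "\<dots> = (\<integral>\<^sup>+Y. ennreal (pmf (step_pmf \<omega> x n h) (h n)) * indicator {restrict h {0..<n}} Y \<partial>?C)"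
  proof (rule nn_integral_cong)
    fix Y assume Y: "Y \<in> space ?C"
    then have Y': "Y \<in> space (PiM {0..<n} ?M)"
      by (simp add: spC)
    then have undef: "Y k = undefined" if "k \<ge> n" for k
      using that by (auto simp: space_PiM PiE_def extensional_def)
    have "(\<lambda>v. Y(n := v)) -` {restrict h {0..<Suc n}} =
          (if Y = restrict h {0..<n} then {h n} else {})"
    proof -
      have "Y(n := v) = restrict h {0..<Suc n} \<longleftrightarrow> Y = restrict h {0..<n} \<and> v = h n" for v
      proof
        assume eq: "Y(n := v) = restrict h {0..<Suc n}"
        show "Y = restrict h {0..<n} \<and> v = h n"
        proof (intro conjI ext)
          show "v = h n"
            using fun_cong[OF eq, of n] by simp
          show "Y k = restrict h {0..<n} k" for k
            using fun_cong[OF eq, of k] undef[of k] by (cases "k < n") simp_all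
        qed
      next
        assume "Y = restrict h {0..<n} \<and> v = h n"
        then have "(Y(n := v)) k = restrict h {0..<Suc n} k" for k
          by (cases "k < n"; cases "k = n") simp_all
        then show "Y(n := v) = restrict h {0..<Suc n}" ..
      qed
      then show ?thesis
        by (simp add: vimage_def)
    qed
    moreover have "step_pmf \<omega> x n (restrict h {0..<n}) = step_pmf \<omega> x n h"
      by (rule step_pmf_cong) simp
    ultimately show "emeasure (cookie.eP \<omega> x n Y) {restrict h {0..<Suc n}} =
        ennreal (pmf (step_pmf \<omega> x n h) (h n)) * indicator {restrict h {0..<n}} Y"
      using cookie.emeasure_eP[OF Y' A, of \<omega> x]
      by (auto simp: emeasure_pmf_single split: split_indicator)
  qed
  also have "\<dots> = emeasure ?C {restrict h {0..<n}} * pmf (step_pmf \<omega> x n h) (h n)"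
    by (subst nn_integral_cmult_indicator) (auto simp: setsC A mult.commute)
  finally show ?thesis .
qed

lemma prob_space_cookie_law: "prob_space (cookie_law \<omega> x)"
proof
  have "cookie.C \<omega> x 0 0 (\<lambda>_. undefined) = return (PiM {0..<0} (\<lambda>_. count_space UNIV)) (\<lambda>_. undefined)"
    by simp
  then show "emeasure (cookie_law \<omega> x) (space (cookie_law \<omega> x)) = 1"
    using emeasure_cookie_law_cylinder[of \<omega> x 0]
    by (simp add: restrict_def PiM_empty)
qed

interpretation cookie_law: prob_space "cookie_law \<omega> x" for \<omega> x
  by (rule prob_space_cookie_law)

lemma measure_cookie_law_Suc:
  "\<P>(X in cookie_law \<omega> x. \<forall>i<Suc n. X i = h i) =
   \<P>(X in cookie_law \<omega> x. \<forall>i<n. X i = h i) * pmf (step_pmf \<omega> x n h) (h n)"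
proof -
  have "emeasure (cookie_law \<omega> x) {X. \<forall>i<Suc n. X i = h i} =
      emeasure (cookie_law \<omega> x) {X. \<forall>i<n. X i = h i} * ennreal (pmf (step_pmf \<omega> x n h) (h n))"
    unfolding emeasure_cookie_law_cylinder by (rule emeasure_C_Suc)
  then show ?thesis
    by (simp add: measure_def enn2real_mult)
qed

lemma measure_cookie_law_0: "\<P>(X in cookie_law \<omega> x. X 0 = x) = 1"
  using measure_cookie_law_Suc[of \<omega> x 0 "\<lambda>_. x"] cookie_law.prob_space[of \<omega> x] by simp

lemma measure_cookie_law_step:
  assumes "0 \<le> \<omega> (h n)" "\<omega> (h n) \<le> 1"
  shows "\<P>(X in cookie_law \<omega> x. (\<forall>i\<le>n. X i = h i) \<and> X (Suc n) = h n + (if right then 1 else - 1)) =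
     \<P>(X in cookie_law \<omega> x. \<forall>i\<le>n. X i = h i) *
     (if right then right_prob \<omega> h n else 1 - right_prob \<omega> h n)"
proof -
  define h' where "h' = h(Suc n := h n + (if right then 1 else - 1))"
  have p: "0 \<le> right_prob \<omega> h n" "right_prob \<omega> h n \<le> 1"
    using assms by (auto simp: right_prob_def)
  have inj: "inj (\<lambda>b. if b then h n + 1 else h n - 1)"
    by (auto simp: inj_on_def)
  have "step_pmf \<omega> x (Suc n) h' = step_pmf \<omega> x (Suc n) h"
    by (rule step_pmf_cong) (simp add: h'_def)
  moreover have "pmf (step_pmf \<omega> x (Suc n) h) (h' (Suc n)) =
      (if right then right_prob \<omega> h n else 1 - right_prob \<omega> h n)"
    using pmf_map_inj'[OF inj, of "bernoulli_pmf (right_prob \<omega> h n)" right] p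
    by (auto simp: h'_def)
  ultimately show ?thesis
    using measure_cookie_law_Suc[of \<omega> x "Suc n" h']
    by (simp add: less_Suc_eq_le le_Suc_eq h'_def all_conj_distrib conj_commute cong: conj_cong imp_cong)
qed

lemma measure_cookie_law_right:
  assumes "0 \<le> \<omega> (h n)" "\<omega> (h n) \<le> 1"
  shows "\<P>(X in cookie_law \<omega> x. (\<forall>i\<le>n. X i = h i) \<and> X (Suc n) = h n + 1) =
     \<P>(X in cookie_law \<omega> x. \<forall>i\<le>n. X i = h i) * right_prob \<omega> h n"
  using assms measure_cookie_law_step[of \<omega> h n x True] by simp

lemma measure_cookie_law_left:
  assumes "0 \<le> \<omega> (h n)" "\<omega> (h n) \<le> 1"
  shows "\<P>(X in cookie_law \<omega> x. (\<forall>i\<le>n. X i = h i) \<and> X (Suc n) = h n - 1) =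
     \<P>(X in cookie_law \<omega> x. \<forall>i\<le>n. X i = h i) * (1 - right_prob \<omega> h n)"
  using assms measure_cookie_law_step[of \<omega> h n x False] by simp

lemma sets_infinitely_often [measurable]:
  "{X. \<exists>\<^sub>\<infinity>n. X n = x} \<in> sets (PiM UNIV (\<lambda>_::nat. count_space (UNIV :: int set)))"
proof -
  have "Measurable.pred (PiM UNIV (\<lambda>_::nat. count_space (UNIV :: int set))) (\<lambda>X. \<exists>\<^sub>\<infinity>n. X n = x)"
    unfolding INFM_nat by measurable
  then show ?thesis
    by (simp add: pred_def space_PiM)
qed

lemma hitting_time_eq_infinity_iff: "hitting_time x X = \<infinity> \<longleftrightarrow> (\<forall>n. X n \<noteq> x)"
  unfolding hitting_time_def by (auto simp: top_enat_def[symmetric] Inf_top_conv) (auto simp: top_enat_def)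

lemma sets_hitting_time_infinity [measurable]:
  "{X. hitting_time x X = \<infinity>} \<in> sets (PiM UNIV (\<lambda>_::nat. count_space (UNIV :: int set)))"
proof -
  have "Measurable.pred (PiM UNIV (\<lambda>_::nat. count_space (UNIV :: int set))) (\<lambda>X. \<forall>n. X n \<noteq> x)"
    by measurable
  then show ?thesis
    by (simp add: pred_def space_PiM hitting_time_eq_infinity_iff)
qed

end

theory Submission
  imports Defs
begin

text \<open>
  A state of the walk is its position together with the set of consumed sites. The position minus
  the drift collected so far, \<open>2 \<omega> z - 1\<close> per visit to an unconsumed site \<open>z\<close>, is a martingale.
  Stopping the walk from \<open>1\<close> at the exit from \<open>(0, b)\<close> and writing \<open>u b\<close> for the probability that
  it exits at \<open>b\<close> gives \<open>b * u b = 1 + (\<Sum>z<b. u z * \<delta> z b)\<close>, where \<open>\<delta> z b\<close> is the expected drift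
  collected at \<open>z\<close>, once reached, before the exit. As \<open>b \<rightarrow> \<infinity>\<close>, \<open>u b\<close> decreases to the escape
  probability; hence the averages of the limits \<open>\<delta> z\<close> over a period are at most \<open>1\<close>, and equal to \<open>1\<close>
  if the escape probability is positive. A visit to \<open>z\<close> is followed by another cookie visit
  exactly if the walk steps right and then returns to \<open>z\<close>. If \<open>\<rho>\<close> denotes the return probability from \<open>z + 1\<close>
  in the fresh environment, this gives \<open>(2 \<omega> z - 1) / (1 - \<omega> z \<rho>) \<le> \<delta> z\<close>, since consuming cookies
  only helps to return, and \<open>\<delta> z \<le> (2 \<omega> z - 1) (1 + \<omega> z \<rho> / (1 - \<omega> z))\<close>.
\<close>

section \<open>Geometric averages\<close>

text \<open>
  The mean of \<open>\<phi> (l + G)\<close>, where \<open>G\<close> counts the steps to the right before the first step to the left.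
\<close>

definition geo :: "real \<Rightarrow> (nat \<Rightarrow> real) \<Rightarrow> nat \<Rightarrow> real" where
  "geo p \<phi> l = (\<Sum>i. (1 - p) * p ^ i * \<phi> (l + i))"

definition unit_valued :: "(nat \<Rightarrow> real) \<Rightarrow> bool" where
  "unit_valued \<phi> \<longleftrightarrow> (\<forall>l. 0 \<le> \<phi> l \<and> \<phi> l \<le> 1)"

lemma unit_valuedD: "unit_valued \<phi> \<Longrightarrow> 0 \<le> \<phi> l" "unit_valued \<phi> \<Longrightarrow> \<phi> l \<le> 1"
  by (auto simp: unit_valued_def)

context
  fixes p :: real
  assumes p: "0 \<le> p" "p < 1"
begin

lemma geo_sums_1: "(\<lambda>i. (1 - p) * p ^ i) sums 1"
  using sums_mult[OF geometric_sums[of p], of "1 - p"] p by simp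

lemma geo_summable:
  assumes "unit_valued \<phi>"
  shows "summable (\<lambda>i. (1 - p) * p ^ i * \<phi> (l + i))"
proof (rule summable_comparison_test')
  show "summable (\<lambda>i. (1 - p) * p ^ i)" using geo_sums_1 by (simp add: sums_iff)
  show "norm ((1 - p) * p ^ i * \<phi> (l + i)) \<le> (1 - p) * p ^ i" for i
    using unit_valuedD[OF assms, of "l + i"] p by (simp add: abs_mult mult_left_le)
qed

lemma geo_const: "geo p (\<lambda>_. k) l = k"
  using sums_mult2[OF geo_sums_1, of k] by (simp add: geo_def sums_iff)

lemma geo_mono:
  assumes "unit_valued \<phi>" "unit_valued \<psi>" "\<And>i. l \<le> i \<Longrightarrow> \<phi> i \<le> \<psi> i"
  shows "geo p \<phi> l \<le> geo p \<psi> l"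
  unfolding geo_def
  by (intro suminf_le geo_summable mult_left_mono assms) (use p in auto)

lemma geo_unit_valued:
  assumes "unit_valued \<phi>" shows "unit_valued (geo p \<phi>)"
proof -
  have "geo p (\<lambda>_. 0) l \<le> geo p \<phi> l" "geo p \<phi> l \<le> geo p (\<lambda>_. 1) l" for l
    by (intro geo_mono assms; use assms in \<open>auto simp: unit_valued_def\<close>)+
  then show ?thesis by (simp add: geo_const unit_valued_def)
qed

lemma geo_rec:
  assumes "unit_valued \<phi>"
  shows "geo p \<phi> l = (1 - p) * \<phi> l + p * geo p \<phi> (Suc l)"
proof -
  have "geo p \<phi> l = (1 - p) * \<phi> l + (\<Sum>i. (1 - p) * p ^ Suc i * \<phi> (l + Suc i))"
    using suminf_split_head[OF geo_summable[OF assms, of l]] by (simp add: geo_def)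
  also have "(\<Sum>i. (1 - p) * p ^ Suc i * \<phi> (l + Suc i)) =
      (\<Sum>i. p * ((1 - p) * p ^ i * \<phi> (Suc l + i)))"
    by (simp add: mult_ac)
  also have "\<dots> = p * geo p \<phi> (Suc l)"
    unfolding geo_def by (rule suminf_mult[OF geo_summable[OF assms]])
  finally show ?thesis .
qed

lemma geo_antimono:
  assumes "unit_valued \<phi>" "antimono \<phi>" shows "antimono (geo p \<phi>)"
proof (rule antimonoI)
  fix l m :: nat assume "l \<le> m"
  then show "geo p \<phi> m \<le> geo p \<phi> l"
    unfolding geo_def using assms(2) p
    by (intro suminf_le geo_summable mult_left_mono assms(1)) (auto simp: antimono_def)
qed

lemma geo_le:
  assumes "unit_valued \<phi>" "antimono \<phi>" shows "geo p \<phi> l \<le> \<phi> l"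
proof -
  have "geo p \<phi> l \<le> geo p (\<lambda>_. \<phi> l) l"
    using assms by (intro geo_mono) (auto simp: antimono_def unit_valued_def)
  then show ?thesis by (simp add: geo_const)
qed

lemma geo_convex:
  assumes "unit_valued \<phi>" "unit_valued \<psi>"
  shows "geo p (\<lambda>l. r * \<phi> l + s * \<psi> l) l = r * geo p \<phi> l + s * geo p \<psi> l"
proof -
  have "(\<lambda>i. r * ((1 - p) * p ^ i * \<phi> (l + i)) + s * ((1 - p) * p ^ i * \<psi> (l + i))) sums
     (r * geo p \<phi> l + s * geo p \<psi> l)"
    unfolding geo_def
    by (intro sums_add sums_mult summable_sums geo_summable assms)
  then show ?thesis unfolding geo_def by (simp add: sums_iff algebra_simps)
qed

end

lemma geo_shift: "geo p (\<lambda>l. \<phi> (Suc l)) = (\<lambda>l. geo p \<phi> (Suc l))"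
  by (simp add: geo_def fun_eq_iff)

text \<open>A larger parameter makes the geometric variable stochastically larger, which lowers the
  mean of an antitone function. The difference satisfies \<open>D l \<le> p' * D (Suc l)\<close>; as
  \<open>D\<close> is at most 1, iteration forces it to be at most 0.\<close>

lemma geo_parameter_antimono:
  assumes "0 \<le> p" "p \<le> p'" "p' < 1" "unit_valued \<phi>" "antimono \<phi>"
  shows "geo p' \<phi> l \<le> geo p \<phi> l"
proof -
  note u = geo_unit_valued[of p, OF _ _ assms(4)] geo_unit_valued[of p', OF _ _ assms(4)]
  define D where "D l = geo p' \<phi> l - geo p \<phi> l" for l
  have rec: "D l \<le> p' * D (Suc l)" for l
  proof -
    have "D l = p' * D (Suc l) - (p' - p) * (\<phi> l - geo p \<phi> (Suc l))"
      using assms geo_rec[of p \<phi> l] geo_rec[of p' \<phi> l] by (simp add: D_def algebra_simps)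
    moreover have "geo p \<phi> (Suc l) \<le> \<phi> (Suc l)" "\<phi> (Suc l) \<le> \<phi> l"
      using assms by (auto intro: geo_le simp: antimono_def)
    ultimately show ?thesis using assms by simp
  qed
  have "D l \<le> p' ^ n" for n l
  proof (induction n arbitrary: l)
    case 0
    show ?case using u assms by (auto simp: D_def unit_valued_def) (smt (verit))
  next
    case (Suc n)
    show ?case using rec[of l] mult_left_mono[OF Suc[of "Suc l"], of p'] assms by simp
  qed
  moreover have "(\<lambda>n. p' ^ n) \<longlonglongrightarrow> 0"
    by (rule LIMSEQ_power_zero) (use assms in auto)
  ultimately have "D l \<le> 0" by (intro tendsto_lowerbound[of _ 0]) auto
  then show ?thesis by (simp add: D_def)
qed

text \<open>The \<open>j\<close>-fold iterate is the mean of \<open>\<phi>\<close> at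
  \<open>l\<close> plus a sum of \<open>j\<close> independent fair geometric variables, that is,
  over \<open>j\<close> runs at a site without cookie.\<close>

lemma geo_funpow:
  assumes "unit_valued \<phi>"
  shows "unit_valued ((geo (1/2) ^^ j) \<phi>)"
    and "antimono \<phi> \<Longrightarrow> antimono ((geo (1/2) ^^ j) \<phi>)"
  using assms by (induction j) (auto intro: geo_unit_valued geo_antimono)

lemma geo_funpow_mono:
  assumes "unit_valued \<phi>" "unit_valued \<psi>" "\<And>i. \<phi> i \<le> \<psi> i"
  shows "(geo (1/2) ^^ j) \<phi> l \<le> (geo (1/2) ^^ j) \<psi> l"
  using assms by (induction j arbitrary: l) (auto intro!: geo_mono geo_funpow)

lemma geo_funpow_shift: "(geo p ^^ j) (\<lambda>l. \<phi> (Suc l)) = (\<lambda>l. (geo p ^^ j) \<phi> (Suc l))"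
  by (induction j) (simp_all add: geo_shift)

lemma geo_funpow_convex:
  assumes "unit_valued \<phi>" "unit_valued \<psi>"
  shows "(geo (1/2) ^^ j) (\<lambda>l. r * \<phi> l + s * \<psi> l) =
    (\<lambda>l. r * (geo (1/2) ^^ j) \<phi> l + s * (geo (1/2) ^^ j) \<psi> l)"
  using assms by (induction j) (auto simp: geo_convex geo_funpow)

text \<open>The averages of \<open>v\<close> tend to \<open>\<theta>\<close>, so division by
  \<open>m\<close> suggests \<open>\<theta> * M \<le> W * \<theta>\<close>. If \<open>W < M\<close>,
  the quantity \<open>a\<close> would eventually drop by at least \<open>\<eta>\<close> per step,
  although it is bounded below.\<close>

lemma sum_bound_limit:
  fixes v :: "nat \<Rightarrow> real"
  assumes v: "v \<longlonglongrightarrow> \<theta>" and \<theta>: "0 < \<theta>"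
    and le: "\<And>m. \<theta> * M * real m \<le> c + W * (\<Sum>j<m. v j)"
  shows "M \<le> W"
proof (rule ccontr)
  assume "\<not> M \<le> W"
  then have W: "W < M" by simp
  \<comment> \<open>Half the gap between \<open>\<theta> * M\<close> and the limit
    \<open>W * \<theta>\<close> of the increments \<open>W * v j\<close>.\<close>
  define \<eta> where "\<eta> = (M - W) * \<theta> / 2"
  define a where "a m = W * (\<Sum>j<m. v j) - \<theta> * M * real m" for m
  have \<eta>: "0 < \<eta>" using W \<theta> by (simp add: \<eta>_def)
  have "(\<lambda>j. W * v j) \<longlonglongrightarrow> W * \<theta>" by (intro tendsto_intros v)
  moreover have "W * \<theta> < \<theta> * M - \<eta>" using W \<theta> by (simp add: \<eta>_def field_simps)
  ultimately have "\<forall>\<^sub>F j in sequentially. W * v j < \<theta> * M - \<eta>"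
    by (rule order_tendstoD)
  then obtain j0 where j0: "\<And>j. j \<ge> j0 \<Longrightarrow> W * v j < \<theta> * M - \<eta>"
    by (auto simp: eventually_sequentially)
  have "a (j0 + k) \<le> a j0 - \<eta> * real k" for k
  proof (induction k)
    case (Suc k)
    then show ?case using j0[of "j0 + k"] by (simp add: a_def algebra_simps)
  qed simp
  moreover have "- c \<le> a m" for m using le[of m] by (simp add: a_def)
  moreover obtain k where "a j0 + c < \<eta> * real k"
    using reals_Archimedean3[OF \<eta>] by (metis mult.commute)
  ultimately show False by (smt (verit))
qed

lemma sum_interval: "(\<Sum>z\<in>{0<..<int (Suc n)}. F z) = (\<Sum>i<n. F (int i + 1))"
  by (rule sum.reindex_bij_witness[of _ "\<lambda>i. int i + 1" "\<lambda>z. nat (z - 1)"]) auto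

section \<open>Potential theory of the walk\<close>

locale cookie_environment =
  fixes \<omega> :: "int \<Rightarrow> real"
  assumes half_le: "1/2 \<le> \<omega> x" and less_1: "\<omega> x < 1"
begin

definition rp :: "int \<Rightarrow> int set \<Rightarrow> real" where
  "rp x C = (if x \<in> C then 1/2 else \<omega> x)"

text \<open>The walk alone remembers its past, but the pair of position and consumed set is a Markov
  chain; this is its transition operator.\<close>

definition step :: "(int \<Rightarrow> int set \<Rightarrow> real) \<Rightarrow> int \<Rightarrow> int set \<Rightarrow> real" where
  "step f x C = rp x C * f (x + 1) C + (1 - rp x C) * f (x - 1) (insert x C)"

lemma rp_bounds: "1/2 \<le> rp x C" "rp x C < 1" "0 < rp x C" "rp x C \<le> 1"
  using half_le[of x] less_1[of x] by (auto simp: rp_def)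

lemma step_mono:
  assumes "f (x + 1) C \<le> g (x + 1) C" "f (x - 1) (insert x C) \<le> g (x - 1) (insert x C)"
  shows "step f x C \<le> step g x C"
  unfolding step_def using assms rp_bounds[of x C] by (intro add_mono mult_left_mono) auto

lemma step_cong:
  assumes "f (x + 1) C = g (x + 1) C" "f (x - 1) (insert x C) = g (x - 1) (insert x C)"
  shows "step f x C = step g x C"
  using assms by (simp add: step_def)

lemma step_const [simp]: "step (\<lambda>x C. k) x C = k"
  by (simp add: step_def algebra_simps)

lemma step_le:
  assumes "f (x + 1) C \<le> k" "f (x - 1) (insert x C) \<le> k" shows "step f x C \<le> k"
  using step_mono[of f x C "\<lambda>_ _. k"] assms by simp

lemma step_ge:
  assumes "k \<le> f (x + 1) C" "k \<le> f (x - 1) (insert x C)" shows "k \<le> step f x C"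
  using step_mono[of "\<lambda>_ _. k" x C f] assms by simp

lemma step_diff: "step (\<lambda>x C. f x C - g x C) x C = step f x C - step g x C"
  by (simp add: step_def algebra_simps)

lemma step_add: "step (\<lambda>x C. f x C + g x C) x C = step f x C + step g x C"
  by (simp add: step_def algebra_simps)

lemma step_cmult: "step (\<lambda>x C. k * f x C) x C = k * step f x C"
  by (simp add: step_def algebra_simps)

lemma step_sum: "step (\<lambda>x C. \<Sum>z\<in>A. f z x C) x C = (\<Sum>z\<in>A. step (f z) x C)"
  by (simp add: step_def sum.distrib sum_distrib_left)

lemma step_position: "step (\<lambda>x C. of_int x) x C = of_int x + (2 * rp x C - 1)"
  by (simp add: step_def algebra_simps)

lemma tendsto_step:
  assumes "\<And>x C. ((\<lambda>n. f n x C) \<longlongrightarrow> g x C) F"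
  shows "((\<lambda>n. step (f n) x C) \<longlongrightarrow> step g x C) F"
  unfolding step_def by (intro tendsto_intros assms)

section \<open>Maximum and comparison principles on an interval\<close>

text \<open>The consumed sets make the state space infinite, so a maximum need not be attained.
  Instead, at most \<open>b - a\<close> steps to the right, each of probability at least 1/2, lead
  out of the domain, where \<open>f\<close> is at most 0; this lowers the bound \<open>B\<close> by
  a fixed factor.\<close>

lemma maximum_principle_contraction:
  assumes B: "0 \<le> B" "\<And>x C. D x C \<Longrightarrow> f x C \<le> B"
    and D: "\<And>x C. D x C \<Longrightarrow> a < x \<and> x < b"
    and sub: "\<And>x C. D x C \<Longrightarrow> f x C \<le> step f x C"
    and right: "\<And>x C. D x C \<Longrightarrow> \<not> D (x + 1) C \<Longrightarrow> f (x + 1) C \<le> 0"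
    and left: "\<And>x C. D x C \<Longrightarrow> \<not> D (x - 1) (insert x C) \<Longrightarrow> f (x - 1) (insert x C) \<le> 0"
    and xC: "D x C"
  shows "f x C \<le> B * (1 - (1/2) ^ nat (b - a))"
proof -
  have *: "f x C \<le> B * (1 - (1/2) ^ n)" if "D x C" "n = nat (b - x)" for n x
    using that
  proof (induction n arbitrary: x)
    case 0
    then show ?case using D[of x C] by simp
  next
    case (Suc n)
    have "f (x + 1) C \<le> B * (1 - (1/2) ^ n)"
    proof (cases "D (x + 1) C")
      case True
      then show ?thesis using Suc by (intro Suc.IH) auto
    next
      case False
      have "0 \<le> B * (1 - (1/2) ^ n)"
        using B by (simp add: power_le_one)
      with right[OF Suc.prems(1) False] show ?thesis by linarith
    qed
    moreover have "f (x - 1) (insert x C) \<le> B"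
      using B left[OF Suc.prems(1)] by (meson order_trans)
    ultimately have "step f x C \<le> rp x C * (B * (1 - (1/2) ^ n)) + (1 - rp x C) * B"
      unfolding step_def using rp_bounds[of x C] by (intro add_mono mult_left_mono) auto
    also have "\<dots> = B - rp x C * (B * (1/2) ^ n)" by (simp add: algebra_simps)
    also have "\<dots> \<le> B - 1/2 * (B * (1/2) ^ n)"
      using B rp_bounds[of x C] by (intro diff_left_mono mult_right_mono) auto
    finally show ?case using sub[OF Suc.prems(1)] by (simp add: algebra_simps)
  qed
  have "(1/2::real) ^ nat (b - a) \<le> (1/2) ^ nat (b - x)"
    using D[OF xC] by (intro power_decreasing) auto
  then have "B * (1 - (1/2) ^ nat (b - x)) \<le> B * (1 - (1/2) ^ nat (b - a))"
    using B by (intro mult_left_mono) auto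
  with *[OF xC refl] show ?thesis by linarith
qed

text \<open>The contraction applies again to the improved bound, which therefore decays
  geometrically to 0. It starts from \<open>max B 0\<close> since the contraction needs a
  nonnegative bound.\<close>

lemma maximum_principle:
  assumes B: "\<And>x C. D x C \<Longrightarrow> f x C \<le> B"
    and D: "\<And>x C. D x C \<Longrightarrow> a < x \<and> x < b"
    and sub: "\<And>x C. D x C \<Longrightarrow> f x C \<le> step f x C"
    and right: "\<And>x C. D x C \<Longrightarrow> \<not> D (x + 1) C \<Longrightarrow> f (x + 1) C \<le> 0"
    and left: "\<And>x C. D x C \<Longrightarrow> \<not> D (x - 1) (insert x C) \<Longrightarrow> f (x - 1) (insert x C) \<le> 0"
    and xC: "D x C"
  shows "f x C \<le> 0"
proof -
  define c where "c = (1 - (1/2::real) ^ nat (b - a))"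
  have c: "0 \<le> c" "c < 1" by (auto simp: c_def power_le_one)
  have *: "f x C \<le> max B 0 * c ^ n" if "D x C" for n x C
    using that
  proof (induction n arbitrary: x C)
    case 0
    then show ?case using B[of x C] by simp
  next
    case (Suc n)
    have "f x C \<le> (max B 0 * c ^ n) * (1 - (1/2) ^ nat (b - a))"
      by (rule maximum_principle_contraction[where D = D and a = a and b = b and f = f])
         (use Suc c D sub right left in auto)
    then show ?case by (simp add: c_def mult_ac)
  qed
  have "(\<lambda>n. max B 0 * c ^ n) \<longlonglongrightarrow> max B 0 * 0"
    by (intro tendsto_intros LIMSEQ_power_zero) (use c in auto)
  then have "f x C \<le> max B 0 * 0"
    by (rule tendsto_lowerbound) (auto intro!: always_eventually *[OF xC])
  then show ?thesis by simp
qed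

text \<open>The common source \<open>c\<close> cancels, so \<open>f - g\<close> is subharmonic. The
  invariant \<open>I\<close> restricts the claim to states closed under steps from inside the
  interval, which carries along what is known about the consumed set.\<close>

lemma comparison:
  assumes B: "\<And>x C. I x C \<Longrightarrow> a < x \<Longrightarrow> x < b \<Longrightarrow> f x C - g x C \<le> B"
    and inv: "\<And>x C. I x C \<Longrightarrow> a < x \<Longrightarrow> x < b \<Longrightarrow> I (x + 1) C \<and> I (x - 1) (insert x C)"
    and f: "\<And>x C. I x C \<Longrightarrow> a < x \<Longrightarrow> x < b \<Longrightarrow> f x C \<le> c x C + step f x C"
    and g: "\<And>x C. I x C \<Longrightarrow> a < x \<Longrightarrow> x < b \<Longrightarrow> c x C + step g x C \<le> g x C"
    and left: "\<And>C. I a C \<Longrightarrow> f a C \<le> g a C"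
    and right: "\<And>C. I b C \<Longrightarrow> f b C \<le> g b C"
    and x: "I x C" "a \<le> x" "x \<le> b"
  shows "f x C \<le> g x C"
proof -
  let ?h = "\<lambda>x C. f x C - g x C" and ?D = "\<lambda>x C. I x C \<and> a < x \<and> x < b"
  have "?h x C \<le> 0" if "?D x C"
  proof (rule maximum_principle[where f = ?h and D = ?D and B = B and a = a and b = b])
    fix x C assume D: "?D x C"
    show "?h x C \<le> B" using B D by blast
    show "a < x \<and> x < b" using D by blast
    show "?h x C \<le> step ?h x C"
      using f[of x C] g[of x C] D by (simp add: step_diff)
    have "x + 1 = b" "I b C" if "\<not> ?D (x + 1) C"
      using D inv[of x C] that by (auto simp: not_less) (metis add1_zle_eq order_antisym)+
    then show "?h (x + 1) C \<le> 0" if "\<not> ?D (x + 1) C"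
      using right[of C] that by auto
    have "x - 1 = a" "I a (insert x C)" if "\<not> ?D (x - 1) (insert x C)"
      using D inv[of x C] that by (auto simp: not_less) (smt (verit))+
    then show "?h (x - 1) (insert x C) \<le> 0" if "\<not> ?D (x - 1) (insert x C)"
      using left[of "insert x C"] that by auto
  qed (use that in auto)
  then show ?thesis
    using x left[of C] right[of C] by (cases "x = a"; cases "x = b") auto
qed

section \<open>Branching representation of hitting probabilities\<close>

text \<open>
  The mean of \<open>\<phi>\<close> at the number of steps to the right from \<open>z\<close> before the \<open>k\<close>-th step to the left.
  Only the first of the \<open>k\<close> runs can use the cookie.
\<close>

definition offspring :: "int \<Rightarrow> int set \<Rightarrow> (nat \<Rightarrow> real) \<Rightarrow> nat \<Rightarrow> real" where
  "offspring z C \<phi> k =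
     (case k of 0 \<Rightarrow> \<phi> 0 | Suc j \<Rightarrow> geo (rp z C) ((geo (1/2) ^^ j) \<phi>) 0)"

lemma offspring_0 [simp]: "offspring z C \<phi> 0 = \<phi> 0"
  and offspring_Suc: "offspring z C \<phi> (Suc j) = geo (rp z C) ((geo (1/2) ^^ j) \<phi>) 0"
  by (simp_all add: offspring_def)

lemma offspring_unit_valued:
  assumes "unit_valued \<phi>" shows "unit_valued (offspring z C \<phi>)"
proof -
  have "0 \<le> offspring z C \<phi> k \<and> offspring z C \<phi> k \<le> 1" for k
    using geo_unit_valued[OF _ _ geo_funpow(1)[OF assms], of "rp z C"] rp_bounds[of z C] assms
    by (cases k) (auto simp: offspring_Suc unit_valued_def)
  then show ?thesis by (simp add: unit_valued_def)
qed

lemma offspring_mono: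
  assumes "unit_valued \<phi>" "unit_valued \<psi>" "\<And>i. \<phi> i \<le> \<psi> i"
  shows "offspring z C \<phi> k \<le> offspring z C \<psi> k"
  using assms rp_bounds[of z C]
  by (cases k) (auto simp: offspring_Suc intro!: geo_mono geo_funpow_mono geo_funpow)

lemma offspring_antimono:
  assumes "unit_valued \<phi>" "antimono \<phi>" shows "antimono (offspring z C \<phi>)"
proof -
  note g = geo_funpow(1)[OF assms(1)] geo_funpow(2)[OF assms]
  have "offspring z C \<phi> (Suc k) \<le> offspring z C \<phi> k" for k
  proof (cases k)
    case 0
    then show ?thesis using assms rp_bounds[of z C] by (auto simp: offspring_Suc intro!: geo_le)
  next
    case (Suc j)
    have "geo (1/2) ((geo (1/2) ^^ j) \<phi>) i \<le> (geo (1/2) ^^ j) \<phi> i" for i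
      using g by (intro geo_le) auto
    then show ?thesis
      using Suc rp_bounds[of z C] g by (auto simp: offspring_Suc intro!: geo_mono geo_unit_valued)
  qed
  then show ?thesis by (rule decseq_SucI)
qed

text \<open>Consuming the cookie of \<open>z\<close> lowers the parameter of the first run, so
  stochastically fewer steps to the right precede the required steps to the left.\<close>

lemma offspring_consumed_mono:
  assumes "unit_valued \<phi>" "antimono \<phi>" "C \<subseteq> C'"
  shows "offspring z C \<phi> k \<le> offspring z C' \<phi> k"
proof (cases k)
  case (Suc j)
  have "rp z C' \<le> rp z C" using assms half_le by (auto simp: rp_def)
  then show ?thesis
    using rp_bounds[of z C] rp_bounds[of z C'] assms
    by (auto simp: offspring_Suc Suc intro!: geo_parameter_antimono geo_funpow)
qed simp

lemma offspring_consumed: "offspring y (insert y C) \<phi> k = (geo (1/2) ^^ k) \<phi> 0"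
  by (cases k) (simp_all add: offspring_Suc rp_def)

text \<open>Splits at the first step from \<open>y\<close>. A step to the right is counted and
  continues the run, hence the shift of \<open>\<phi>\<close>; a step to the left ends the first
  run, consumes \<open>y\<close> and leaves \<open>k\<close> steps to the left.\<close>

lemma offspring_rec:
  assumes "unit_valued \<phi>"
  shows "offspring y C \<phi> (Suc k) =
    rp y C * offspring y C (\<lambda>l. \<phi> (Suc l)) (Suc k) + (1 - rp y C) * offspring y (insert y C) \<phi> k"
  using geo_rec[OF _ _ geo_funpow(1)[OF assms], of "rp y C" k 0] rp_bounds[of y C]
  by (simp add: offspring_Suc offspring_consumed geo_shift geo_funpow_shift algebra_simps)

lemma offspring_convex:
  assumes "unit_valued \<phi>" "unit_valued \<psi>"
  shows "offspring z C (\<lambda>l. r * \<phi> l + s * \<psi> l) k = r * offspring z C \<phi> k + s * offspring z C \<psi> k"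
  using assms rp_bounds[of z C]
  by (cases k) (simp_all add: offspring_Suc geo_funpow_convex geo_convex geo_funpow)

text \<open>
  Branching representation; \<open>k = 0\<close> gives the probability to hit \<open>b - d - 1\<close> before \<open>b\<close> from
  position \<open>y\<close>. When \<open>k\<close> steps from \<open>b - d - 1\<close> to the right have to be undone, the walk has to step left from
  \<open>b - d\<close> \<open>k\<close> times, and once more if it starts at \<open>b - d\<close> or above. In contrast to the one-step recursion,
  this formula makes monotonicity in the set of consumed sites evident.
\<close>

primrec chi :: "int \<Rightarrow> int set \<Rightarrow> int \<Rightarrow> nat \<Rightarrow> nat \<Rightarrow> real" where
  "chi b C y 0 k = (if y < b \<and> k = 0 then 1 else 0)"
| "chi b C y (Suc d) k =
     offspring (b - 1 - int d) C (chi b C y d) (if b - 1 - int d \<le> y then Suc k else k)"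

lemma chi_unit_valued: "unit_valued (chi b C y d)"
proof (induction d)
  case 0
  then show ?case by (simp add: unit_valued_def)
next
  case (Suc d)
  then show ?case using offspring_unit_valued[OF Suc] by (simp add: unit_valued_def)
qed

lemma chi_antimono: "antimono (chi b C y d)"
proof (induction d)
  case 0
  then show ?case by (simp add: antimono_def)
next
  case (Suc d)
  then show ?case using offspring_antimono[OF chi_unit_valued Suc] by (simp add: antimono_def)
qed

text \<open>At each level first the inner function and then the parameter of the run is replaced;
  the second comparison rests on \<open>chi_antimono\<close>.\<close>

lemma chi_consumed_mono: "C \<subseteq> C' \<Longrightarrow> chi b C y d k \<le> chi b C' y d k"
proof (induction d arbitrary: k)
  case 0
  then show ?case by simp
next
  case (Suc d)
  have "offspring z C (chi b C y d) k \<le> offspring z C' (chi b C' y d) k" for z k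
    by (rule order_trans[OF offspring_mono offspring_consumed_mono])
       (use Suc chi_unit_valued chi_antimono in auto)
  then show ?case by simp
qed

lemma chi_local:
  "C \<inter> {b - int d..} = C' \<inter> {b - int d..} \<Longrightarrow> chi b C y d k = chi b C' y d k"
proof (induction d arbitrary: k)
  case 0
  then show ?case by simp
next
  case (Suc d)
  have *: "x \<in> C \<longleftrightarrow> x \<in> C'" if "b - 1 - int d \<le> x" for x
  proof -
    have "x \<in> C \<inter> {b - int (Suc d)..} \<longleftrightarrow> x \<in> C' \<inter> {b - int (Suc d)..}"
      by (simp only: Suc.prems)
    with that show ?thesis by simp
  qed
  have "chi b C y d = chi b C' y d"
    by (rule ext, rule Suc.IH) (use * in auto)
  moreover have "rp (b - 1 - int d) C = rp (b - 1 - int d) C'"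
    by (simp add: rp_def *)
  ultimately show ?case by (simp add: offspring_def split: nat.split)
qed

lemma chi_insert_below: "y < b - int d \<Longrightarrow> chi b (insert y C) y' d k = chi b C y' d k"
  by (rule chi_local) auto

text \<open>Depth \<open>d\<close> treats only the sites from \<open>b - d\<close> to
  \<open>b - 1\<close>, so starting points below them are indistinguishable.\<close>

lemma chi_below: "y < b - int d \<Longrightarrow> y' < b - int d \<Longrightarrow> chi b C y d k = chi b C y' d k"
proof (induction d arbitrary: k)
  case (Suc d)
  then have "chi b C y d = chi b C y' d" by (intro ext Suc.IH) auto
  with Suc.prems show ?case by simp
qed simp

lemma chi_0: "y < b - int d \<Longrightarrow> chi b C y d 0 = 1"
  by (induction d) auto

lemma chi_above: "b \<le> y \<Longrightarrow> chi b C y d k = 0"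
proof (induction d arbitrary: k)
  case (Suc d)
  then have "chi b C y d = (\<lambda>_. 0)" by auto
  moreover have "(geo (1/2) ^^ j) (\<lambda>_. 0) = (\<lambda>_. 0)" for j
    by (induction j) (auto simp: geo_const)
  moreover have "geo (rp z C) (\<lambda>_. 0) 0 = 0" for z
    using rp_bounds[of z C] by (simp add: geo_const)
  ultimately show ?case by (simp add: offspring_def split: nat.split)
qed simp

text \<open>A start at the lowest treated site \<open>b - d\<close> owes one extra step to the left
  from it, just as a crossing from below does.\<close>

lemma chi_right: "b - int d = y + 1 \<Longrightarrow> chi b C (y + 1) d k = chi b C y d (Suc k)"
proof (cases d)
  case (Suc d')
  moreover assume "b - int d = y + 1"
  ultimately show ?thesis using chi_below[of "y+1" b d' y C]
    by (auto intro!: arg_cong2[of _ _ _ _ "offspring _ _"])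
qed auto

text \<open>The branching formula solves the one-step equation, which makes the comparison principle
  applicable to it. If the newly treated site is \<open>y\<close> itself,
  \<open>offspring_rec\<close> splits the first step; if it lies below \<open>y\<close>, the first
  step does not concern it and the average passes through the linear
  \<open>offspring\<close>.\<close>

lemma chi_harmonic:
  assumes "b - int d \<le> y" "y < b"
  shows "chi b C y d k =
    rp y C * chi b C (y + 1) d k + (1 - rp y C) * chi b (insert y C) (y - 1) d k"
  using assms
proof (induction d arbitrary: k)
  case 0
  then show ?case by simp
next
  case (Suc d)
  let ?z = "b - 1 - int d"
  show ?case
  proof (cases "?z = y")
    case True
    have 1: "chi b C (y + 1) d = (\<lambda>l. chi b C y d (Suc l))"
      by (rule ext, rule chi_right) (use True in auto)
    \<comment> \<open>Depth \<open>d\<close> sees only the sites above \<open>y\<close>, hence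
      neither the consumption of \<open>y\<close> nor the move to \<open>y - 1\<close>.\<close>
    have 2: "chi b (insert y C) (y - 1) d = chi b C y d"
    proof
      fix k
      have "chi b (insert y C) (y - 1) d k = chi b C (y - 1) d k"
        by (rule chi_insert_below) (use True in auto)
      also have "\<dots> = chi b C y d k"
        by (rule chi_below) (use True in auto)
      finally show "chi b (insert y C) (y - 1) d k = chi b C y d k" .
    qed
    show ?thesis
      using offspring_rec[OF chi_unit_valued, of y C b C y d k] True by (simp add: 1 2)
  next
    case False
    with Suc.prems have z: "?z < y" by auto
    have "chi b C y d = (\<lambda>k. rp y C * chi b C (y + 1) d k + (1 - rp y C) * chi b (insert y C) (y - 1) d k)"
      by (rule ext, rule Suc.IH) (use z Suc.prems in auto)
    moreover have "rp ?z (insert y C) = rp ?z C"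
      using z by (simp add: rp_def)
    then have "offspring ?z (insert y C) = offspring ?z C"
      by (simp add: offspring_def fun_eq_iff split: nat.split)
    ultimately show ?thesis
      using z by (simp add: offspring_convex chi_unit_valued)
  qed
qed

section \<open>Reaching one end of an interval before the other\<close>

text \<open>The depth \<open>b - a - 1\<close> treats exactly the sites strictly between
  \<open>a\<close> and \<open>b\<close>, and \<open>k = 0\<close> since no step from
  \<open>a\<close> to the right has to be undone. The closed form inherits monotonicity and locality
  in the consumed set.\<close>

definition hit_before :: "int \<Rightarrow> int \<Rightarrow> int \<Rightarrow> int set \<Rightarrow> real" where
  "hit_before a b x C = chi b C x (nat (b - a - 1)) 0"

lemma hit_before_bounds: "0 \<le> hit_before a b x C" "hit_before a b x C \<le> 1"
  using chi_unit_valued by (auto simp: hit_before_def unit_valued_def)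

lemma hit_before_left: "a < b \<Longrightarrow> hit_before a b a C = 1"
  by (auto simp: hit_before_def intro!: chi_0)

lemma hit_before_right: "b \<le> x \<Longrightarrow> hit_before a b x C = 0"
  by (simp add: hit_before_def chi_above)

lemma hit_before_step: "a < x \<Longrightarrow> x < b \<Longrightarrow> step (hit_before a b) x C = hit_before a b x C"
  unfolding hit_before_def step_def by (rule chi_harmonic[symmetric]) auto

lemma hit_before_consumed_mono: "C \<subseteq> C' \<Longrightarrow> hit_before a b x C \<le> hit_before a b x C'"
  by (simp add: hit_before_def chi_consumed_mono)

lemma hit_before_local:
  assumes "a < b" and C: "C \<inter> {a<..} = C' \<inter> {a<..}"
  shows "hit_before a b x C = hit_before a b x C'"
proof -
  have "{b - int (nat (b - a - 1))..} = {a<..}" using \<open>a < b\<close> by auto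
  then have "C \<inter> {b - int (nat (b - a - 1))..} = C' \<inter> {b - int (nat (b - a - 1))..}"
    using C by metis
  then show ?thesis
    unfolding hit_before_def by (rule chi_local)
qed

lemma comparison_eq:
  assumes B: "\<And>x C. I x C \<Longrightarrow> a < x \<Longrightarrow> x < b \<Longrightarrow> \<bar>f x C - g x C\<bar> \<le> B"
    and inv: "\<And>x C. I x C \<Longrightarrow> a < x \<Longrightarrow> x < b \<Longrightarrow> I (x + 1) C \<and> I (x - 1) (insert x C)"
    and f: "\<And>x C. I x C \<Longrightarrow> a < x \<Longrightarrow> x < b \<Longrightarrow> f x C = c x C + step f x C"
    and g: "\<And>x C. I x C \<Longrightarrow> a < x \<Longrightarrow> x < b \<Longrightarrow> g x C = c x C + step g x C"
    and left: "\<And>C. I a C \<Longrightarrow> f a C = g a C"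
    and right: "\<And>C. I b C \<Longrightarrow> f b C = g b C"
    and x: "I x C" "a \<le> x" "x \<le> b"
  shows "f x C = g x C"
proof (rule antisym)
  show "f x C \<le> g x C"
  proof (rule comparison[where I = I and a = a and b = b and c = c and B = B])
    show "f x C - g x C \<le> B" if "I x C" "a < x" "x < b" for x C
      using B[OF that] by simp
    show "f x C \<le> c x C + step f x C" "c x C + step g x C \<le> g x C"
      if "I x C" "a < x" "x < b" for x C
      using f[OF that] g[OF that] by simp_all
    show "f a C \<le> g a C" if "I a C" for C using left[OF that] by simp
    show "f b C \<le> g b C" if "I b C" for C using right[OF that] by simp
  qed (use inv x in auto)
  show "g x C \<le> f x C"
  proof (rule comparison[where I = I and a = a and b = b and c = c and B = B])
    show "g x C - f x C \<le> B" if "I x C" "a < x" "x < b" for x C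
      using B[OF that] by simp
    show "g x C \<le> c x C + step g x C" "c x C + step f x C \<le> f x C"
      if "I x C" "a < x" "x < b" for x C
      using f[OF that] g[OF that] by simp_all
    show "g a C \<le> f a C" if "I a C" for C using left[OF that] by simp
    show "g b C \<le> f b C" if "I b C" for C using right[OF that] by simp
  qed (use inv x in auto)
qed

section \<open>Cookie visits and the balance of drift\<close>

text \<open>The expected number of visits to \<open>z\<close> with its cookie, up to the exit from \<open>(0, b)\<close>.\<close>

primrec visits_within :: "int \<Rightarrow> int \<Rightarrow> nat \<Rightarrow> int \<Rightarrow> int set \<Rightarrow> real" where
  "visits_within z b 0 x C = 0"
| "visits_within z b (Suc n) x C =
     (if 0 < x \<and> x < b then of_bool (x = z \<and> z \<notin> C) + step (visits_within z b n) x C else 0)"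

lemma visits_within_nonneg: "0 \<le> visits_within z b n x C"
  by (induction n arbitrary: x C) (auto intro!: add_nonneg_nonneg step_ge)

lemma visits_within_mono: "visits_within z b n x C \<le> visits_within z b (Suc n) x C"
proof (induction n arbitrary: x C)
  case 0
  show ?case using visits_within_nonneg[of z b "Suc 0" x C] by simp
next
  case (Suc n)
  have "step (visits_within z b n) x C \<le> step (visits_within z b (Suc n)) x C"
    by (rule step_mono) (rule Suc)+
  then show ?case
    unfolding visits_within.simps(2)[of z b "Suc n"] visits_within.simps(2)[of z b n] by auto
qed

text \<open>Each visit with the cookie consumes it with probability \<open>1 - \<omega> z\<close>,
  so the number of such visits is dominated by a geometric variable. The bound is a fixed point of
  the recursion inside the interval.\<close>

lemma visits_within_le: "visits_within z b n x C \<le> of_bool (z \<notin> C) / (1 - \<omega> z)"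
proof (induction n arbitrary: x C)
  case 0
  then show ?case using less_1[of z] by (auto simp: divide_simps)
next
  case (Suc n)
  let ?v = "\<lambda>x C. of_bool (z \<notin> C) / (1 - \<omega> z)"
  have "step (visits_within z b n) x C \<le> step ?v x C"
    by (rule step_mono) (rule Suc)+
  moreover have "of_bool (x = z \<and> z \<notin> C) + step ?v x C = ?v x C"
    using less_1[of z] by (auto simp: step_def rp_def divide_simps)
  moreover have "0 \<le> ?v x C" using less_1[of z] by simp
  ultimately show ?case by simp
qed

definition visits :: "int \<Rightarrow> int \<Rightarrow> int \<Rightarrow> int set \<Rightarrow> real" where
  "visits z b x C = lim (\<lambda>n. visits_within z b n x C)"

lemma visits_within_tendsto: "(\<lambda>n. visits_within z b n x C) \<longlonglongrightarrow> visits z b x C"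
proof -
  have "incseq (\<lambda>n. visits_within z b n x C)"
    by (intro incseq_SucI visits_within_mono)
  then have "convergent (\<lambda>n. visits_within z b n x C)"
    by (rule incseq_convergent[of _ "of_bool (z \<notin> C) / (1 - \<omega> z)"])
       (use visits_within_le in \<open>auto simp: convergent_def\<close>)
  then show ?thesis by (simp add: visits_def convergent_LIMSEQ_iff)
qed

lemma visits_nonneg: "0 \<le> visits z b x C"
  by (rule LIMSEQ_le_const[OF visits_within_tendsto]) (auto intro: visits_within_nonneg)

lemma visits_le: "visits z b x C \<le> of_bool (z \<notin> C) / (1 - \<omega> z)"
  by (rule LIMSEQ_le_const2[OF visits_within_tendsto]) (use visits_within_le in blast)

lemma visits_le': "visits z b x C \<le> 1 / (1 - \<omega> z)"
  using visits_le[of z b x C] less_1[of z] by (cases "z \<in> C") (auto intro: order_trans)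

lemma visits_consumed: "z \<in> C \<Longrightarrow> visits z b x C = 0"
  using visits_le[of z b x C] visits_nonneg[of z b x C] by simp

lemma visits_outside: "\<not> (0 < x \<and> x < b) \<Longrightarrow> visits z b x C = 0"
proof -
  assume *: "\<not> (0 < x \<and> x < b)"
  have "visits_within z b n x C = 0" for n using * by (cases n) auto
  with visits_within_tendsto[of z b x C] show ?thesis by (simp add: LIMSEQ_const_iff)
qed

lemma visits_rec:
  assumes "0 < x" "x < b"
  shows "visits z b x C = of_bool (x = z \<and> z \<notin> C) + step (visits z b) x C"
proof (rule LIMSEQ_unique)
  show "(\<lambda>n. visits_within z b (Suc n) x C) \<longlonglongrightarrow> visits z b x C"
    by (rule LIMSEQ_Suc[OF visits_within_tendsto])
  show "(\<lambda>n. visits_within z b (Suc n) x C) \<longlonglongrightarrow>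
      of_bool (x = z \<and> z \<notin> C) + step (visits z b) x C"
    using assms by (auto intro!: tendsto_intros tendsto_step visits_within_tendsto)
qed

text \<open>Optional stopping of the martingale at the exit from \<open>(0, b)\<close>, expressed
  without stopping times: both sides satisfy the same one-step equation and agree at 0 and at
  \<open>b\<close>.\<close>

lemma balance:
  assumes "0 < b" "0 \<le> x" "x \<le> b"
  shows "of_int b * (1 - hit_before 0 b x C) =
    of_int x + (\<Sum>z\<in>{0<..<b}. (2 * \<omega> z - 1) * visits z b x C)"
proof (rule comparison_eq[where I = "\<lambda>_ _. True" and a = 0 and b = b and c = "\<lambda>_ _. 0"
      and f = "\<lambda>x C. of_int b * (1 - hit_before 0 b x C)"
      and g = "\<lambda>x C. of_int x + (\<Sum>z\<in>{0<..<b}. (2 * \<omega> z - 1) * visits z b x C)"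
      and B = "2 * of_int b + (\<Sum>z\<in>{0<..<b}. (2 * \<omega> z - 1) * (1 / (1 - \<omega> z)))"])
  let ?f = "\<lambda>x C. of_int b * (1 - hit_before 0 b x C)"
  let ?g = "\<lambda>x C. of_int x + (\<Sum>z\<in>{0<..<b}. (2 * \<omega> z - 1) * visits z b x C)"
  fix x :: int and C :: "int set" assume x: "0 < x" "x < b"
  have w: "0 \<le> 2 * \<omega> z - 1" for z using half_le[of z] by simp
  have "0 \<le> ?f x C" "?f x C \<le> of_int b"
    using hit_before_bounds[of 0 b x C] assms by (auto simp: mult_left_le)
  moreover have "0 \<le> ?g x C" using x w
    by (intro add_nonneg_nonneg sum_nonneg mult_nonneg_nonneg visits_nonneg) auto
  moreover have "?g x C \<le> of_int b + (\<Sum>z\<in>{0<..<b}. (2 * \<omega> z - 1) * (1 / (1 - \<omega> z)))"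
    using x w visits_le' by (intro add_mono sum_mono mult_left_mono) auto
  ultimately show "\<bar>?f x C - ?g x C\<bar> \<le>
      2 * of_int b + (\<Sum>z\<in>{0<..<b}. (2 * \<omega> z - 1) * (1 / (1 - \<omega> z)))"
    using assms by linarith
  show "?f x C = 0 + step ?f x C"
    using hit_before_step[OF x, of C] by (simp add: step_cmult step_diff)
  have "step ?g x C = of_int x + (2 * rp x C - 1) +
      (\<Sum>z\<in>{0<..<b}. (2 * \<omega> z - 1) * step (visits z b) x C)"
    by (simp only: step_add step_position step_sum step_cmult)
  also have "\<dots> = of_int x + (2 * rp x C - 1) + (\<Sum>z\<in>{0<..<b}. (2 * \<omega> z - 1) * visits z b x C)
      - (\<Sum>z\<in>{0<..<b}. (2 * \<omega> z - 1) * of_bool (x = z \<and> z \<notin> C))"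
  proof -
    have "step (visits z b) x C = visits z b x C - of_bool (x = z \<and> z \<notin> C)" for z
      using visits_rec[OF x, of z C] by simp
    then show ?thesis by (simp only: right_diff_distrib sum_subtractf add_diff_eq)
  qed
  \<comment> \<open>Only \<open>z = x\<close> contributes, and nothing at all if \<open>x\<close> is
    consumed, when \<open>2 * rp x C - 1\<close> vanishes as well. The sum thus cancels the drift of
    the position.\<close>
  also have "(\<Sum>z\<in>{0<..<b}. (2 * \<omega> z - 1) * of_bool (x = z \<and> z \<notin> C)) =
      (\<Sum>z\<in>{0<..<b}. if z = x then 2 * rp x C - 1 else 0)"
    by (intro sum.cong) (auto simp: rp_def)
  also have "\<dots> = 2 * rp x C - 1" using x by simp
  finally show "?g x C = 0 + step ?g x C" by simp
qed (use assms in \<open>auto simp: hit_before_left hit_before_right visits_outside\<close>)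

lemma hit_before_mono:
  assumes "a < b" "b \<le> b'" "a \<le> x" "x \<le> b" shows "hit_before a b x C \<le> hit_before a b' x C"
proof (rule comparison[where I = "\<lambda>_ _. True" and a = a and b = b
      and c = "\<lambda>_ _. 0" and B = 1 and f = "hit_before a b" and g = "hit_before a b'"])
  show "hit_before a b x C - hit_before a b' x C \<le> 1" for x C
    using hit_before_bounds[of a b x C] hit_before_bounds[of a b' x C] by linarith
qed (use assms hit_before_bounds in \<open>auto simp: hit_before_step hit_before_left hit_before_right\<close>)

text \<open>On the first arrival at \<open>z\<close> all sites from \<open>z\<close> on are fresh.
  That visit counts once; a further one needs a step to the right and a return to \<open>z\<close>,
  after which at most \<open>1 / (1 - \<omega> z)\<close> visits are expected.\<close>

lemma visits_le_return:
  assumes z: "0 < z" "z < b" and C: "C \<inter> {z..} = {}" and x: "0 \<le> x" "x \<le> z"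
  shows "visits z b x C \<le>
    (1 - hit_before 0 z x C) * (1 + \<omega> z * hit_before z b (z + 1) {} / (1 - \<omega> z))"
proof -
  define E where "E = 1 + \<omega> z * hit_before z b (z + 1) {} / (1 - \<omega> z)"
  have w: "0 < \<omega> z" "0 < 1 - \<omega> z" using half_le[of z] less_1[of z] by auto
  then have E: "0 \<le> E" unfolding E_def using hit_before_bounds
    by (intro add_nonneg_nonneg divide_nonneg_nonneg mult_nonneg_nonneg) auto
  have 1: "visits z b x C \<le> 1 / (1 - \<omega> z) * hit_before z b x C" if "z \<le> x" "x \<le> b" for x C
  proof (rule comparison[where I = "\<lambda>_ _. True" and a = z and b = b and c = "\<lambda>_ _. 0"
        and f = "visits z b" and g = "\<lambda>x C. 1 / (1 - \<omega> z) * hit_before z b x C"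
        and B = "1 / (1 - \<omega> z)"])
    fix x :: int and C :: "int set" assume x: "z < x" "x < b"
    show "visits z b x C - 1 / (1 - \<omega> z) * hit_before z b x C \<le> 1 / (1 - \<omega> z)"
      using visits_le'[of z b x C] hit_before_bounds[of z b x C] w
      by (smt (verit) divide_nonneg_pos mult_nonneg_nonneg)
    show "visits z b x C \<le> 0 + step (visits z b) x C"
      using visits_rec[of x b z C] x z by simp
    show "0 + step (\<lambda>x C. 1 / (1 - \<omega> z) * hit_before z b x C) x C
        \<le> 1 / (1 - \<omega> z) * hit_before z b x C"
      using x by (simp only: step_cmult hit_before_step add_0 order_refl)
  qed (use visits_le' visits_outside hit_before_left hit_before_right that z in auto)
  have 2: "visits z b z C \<le> E" if "C \<inter> {z..} = {}" for C
  proof -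
    have zC: "z \<notin> C" using that by auto
    have "visits z b z C = 1 + \<omega> z * visits z b (z + 1) C"
      using visits_rec[OF z, of z C] zC by (simp add: step_def rp_def visits_consumed)
    also have "\<dots> \<le> 1 + \<omega> z * (1 / (1 - \<omega> z) * hit_before z b (z + 1) C)"
      using 1[of "z + 1" C] w z by (intro add_left_mono mult_left_mono) auto
    also have "hit_before z b (z + 1) C = hit_before z b (z + 1) {}"
      using that by (intro hit_before_local z) (auto simp: disjoint_iff)
    finally show ?thesis by (simp add: E_def)
  qed
  show ?thesis
    unfolding E_def[symmetric]
  proof (rule comparison[where I = "\<lambda>_ C. C \<inter> {z..} = {}" and a = 0 and b = z and c = "\<lambda>_ _. 0"
        and f = "visits z b" and g = "\<lambda>x C. (1 - hit_before 0 z x C) * E"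
        and B = "1 / (1 - \<omega> z)"])
    fix x :: int and C :: "int set" assume x: "0 < x" "x < z"
    show "visits z b x C - (1 - hit_before 0 z x C) * E \<le> 1 / (1 - \<omega> z)"
      using visits_le'[of z b x C] hit_before_bounds[of 0 z x C] E
      by (smt (verit) mult_nonneg_nonneg)
    show "visits z b x C \<le> 0 + step (visits z b) x C"
      using visits_rec[of x b z C] x z by simp
    show "0 + step (\<lambda>x C. (1 - hit_before 0 z x C) * E) x C \<le> (1 - hit_before 0 z x C) * E"
      using x by (simp add: mult.commute[of _ E] step_cmult step_diff hit_before_step)
    show "C \<inter> {z..} = {} \<Longrightarrow> C \<inter> {z..} = {} \<and> insert x C \<inter> {z..} = {}"
      using x by auto
  qed (use visits_outside hit_before_left hit_before_right x z C 2 in auto)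
qed

text \<open>Every further round from \<open>z\<close>, a step to the right and a return, has
  probability at least \<open>\<omega> z * \<rho>\<close>, since cookies consumed in earlier rounds
  make a return more likely. The geometric series of rounds has the sum \<open>E\<close>.\<close>

lemma visits_ge_return:
  assumes z: "0 < z" "z < b" and C: "C \<inter> {z..} = {}" and x: "0 \<le> x" "x \<le> z"
  shows "(1 - hit_before 0 z x C) / (1 - \<omega> z * hit_before z b (z + 1) {}) \<le> visits z b x C"
proof -
  define \<rho> where "\<rho> = hit_before z b (z + 1) {}"
  define E where "E = 1 / (1 - \<omega> z * \<rho>)"
  have w: "0 < \<omega> z" "\<omega> z < 1" using half_le[of z] less_1[of z] by auto
  have \<rho>: "0 \<le> \<rho>" "\<rho> \<le> 1" using hit_before_bounds by (auto simp: \<rho>_def)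
  have "\<omega> z * \<rho> < 1" using w \<rho> by (smt (verit) mult_left_le)
  then have E: "0 \<le> E" "1 + \<omega> z * \<rho> * E = E" by (auto simp: E_def divide_simps)
  \<comment> \<open>The left end \<open>z - 1\<close> makes \<open>z\<close> an interior point. At
    \<open>z - 1\<close> the value is 0, because the step to the left from \<open>z\<close> has
    consumed its cookie; until then the cookie stays, as the invariant records.\<close>
  let ?f = "\<lambda>x C. if x = z - 1 then 0 else E * hit_before z b x C"
  have fE: "0 \<le> ?f x C" "?f x C \<le> E" for x C
    using E hit_before_bounds[of z b x C] by (auto simp: mult_left_le)
  have 2: "E \<le> visits z b z C" if "z \<notin> C" for C
  proof -
    have "?f z C \<le> visits z b z C"
    proof (rule comparison[where I = "\<lambda>x C. z \<notin> C \<or> x = z - 1" and a = "z - 1" and b = b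
          and c = "\<lambda>x C. of_bool (x = z \<and> z \<notin> C)" and f = ?f and g = "visits z b" and B = E])
      fix x :: int and C :: "int set"
      assume I: "z \<notin> C \<or> x = z - 1" and x: "z - 1 < x" "x < b"
      then have zC: "z \<notin> C" by auto
      show "?f x C - visits z b x C \<le> E"
        using fE[of x C] visits_nonneg[of z b x C] by linarith
      show "(z \<notin> C \<or> x + 1 = z - 1) \<and> (z \<notin> insert x C \<or> x - 1 = z - 1)"
        using zC by auto
      show "of_bool (x = z \<and> z \<notin> C) + step (visits z b) x C \<le> visits z b x C"
        using visits_rec[of x b z C] x z by simp
      show "?f x C \<le> of_bool (x = z \<and> z \<notin> C) + step ?f x C"
      proof (cases "x = z")
        case True
        have "\<omega> z * \<rho> * E \<le> \<omega> z * (E * hit_before z b (z + 1) C)"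
          using hit_before_consumed_mono[of "{}" C z b "z + 1"] w E
          by (simp add: \<rho>_def mult_left_mono mult_right_mono mult.assoc mult.commute[of E])
        then show ?thesis
          using True zC z E by (simp add: hit_before_left step_def rp_def)
      next
        case False
        have "step ?f x C = step (\<lambda>x C. E * hit_before z b x C) x C"
          using x False by (intro step_cong) auto
        also have "\<dots> = E * hit_before z b x C"
          using x False by (simp add: step_cmult hit_before_step)
        finally show ?thesis using x by simp
      qed
    qed (use that z visits_nonneg hit_before_right in auto)
    then show ?thesis using z by (simp add: hit_before_left)
  qed
  have "(1 - hit_before 0 z x C) * E \<le> visits z b x C"
  proof (rule comparison[where I = "\<lambda>_ C. C \<inter> {z..} = {}" and a = 0 and b = z and c = "\<lambda>_ _. 0"
        and g = "visits z b" and f = "\<lambda>x C. (1 - hit_before 0 z x C) * E"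
        and B = "E"])
    fix x :: int and C :: "int set" assume x: "0 < x" "x < z"
    show "(1 - hit_before 0 z x C) * E - visits z b x C \<le> E"
      using visits_nonneg[of z b x C] hit_before_bounds[of 0 z x C] E
      by (smt (verit) mult_left_le_one_le)
    show "0 + step (visits z b) x C \<le> visits z b x C"
      using visits_rec[of x b z C] x z by simp
    show "(1 - hit_before 0 z x C) * E \<le> 0 + step (\<lambda>x C. (1 - hit_before 0 z x C) * E) x C"
      using x by (simp add: mult.commute[of _ E] step_cmult step_diff hit_before_step)
    show "C \<inter> {z..} = {} \<Longrightarrow> C \<inter> {z..} = {} \<and> insert x C \<inter> {z..} = {}"
      using x by auto
  next
    show "(1 - hit_before 0 z z C) * E \<le> visits z b z C" if "C \<inter> {z..} = {}" for C
      using 2[of C] that by (auto simp: hit_before_right)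
  qed (use visits_nonneg hit_before_left x z C in auto)
  then show ?thesis by (simp add: E_def \<rho>_def)
qed

lemma balance_le:
  assumes "0 < b"
  shows "of_int b * (1 - hit_before 0 b 1 {}) \<le> 1 + (\<Sum>z\<in>{0<..<b}. (2 * \<omega> z - 1) *
    ((1 - hit_before 0 z 1 {}) * (1 + \<omega> z * hit_before z b (z + 1) {} / (1 - \<omega> z))))"
proof -
  have "0 \<le> 2 * \<omega> z - 1" for z using half_le[of z] by simp
  then have "(\<Sum>z\<in>{0<..<b}. (2 * \<omega> z - 1) * visits z b 1 {}) \<le> (\<Sum>z\<in>{0<..<b}. (2 * \<omega> z - 1) *
    ((1 - hit_before 0 z 1 {}) * (1 + \<omega> z * hit_before z b (z + 1) {} / (1 - \<omega> z))))"
    by (intro sum_mono mult_left_mono visits_le_return) auto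
  then show ?thesis using balance[of b 1 "{}"] assms by simp
qed

lemma balance_ge:
  assumes "0 < b"
  shows "1 + (\<Sum>z\<in>{0<..<b}. (2 * \<omega> z - 1) *
    ((1 - hit_before 0 z 1 {}) / (1 - \<omega> z * hit_before z b (z + 1) {}))) \<le>
    of_int b * (1 - hit_before 0 b 1 {})"
proof -
  have "0 \<le> 2 * \<omega> z - 1" for z using half_le[of z] by simp
  then have "(\<Sum>z\<in>{0<..<b}. (2 * \<omega> z - 1) *
      ((1 - hit_before 0 z 1 {}) / (1 - \<omega> z * hit_before z b (z + 1) {}))) \<le>
      (\<Sum>z\<in>{0<..<b}. (2 * \<omega> z - 1) * visits z b 1 {})"
    by (intro sum_mono mult_left_mono visits_ge_return) auto
  then show ?thesis using balance[of b 1 "{}"] assms by simp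
qed

section \<open>Eventual hitting\<close>

primrec hit_within :: "int \<Rightarrow> nat \<Rightarrow> int \<Rightarrow> int set \<Rightarrow> real" where
  "hit_within a 0 x C = of_bool (x = a)"
| "hit_within a (Suc n) x C = (if x = a then 1 else step (hit_within a n) x C)"

lemma hit_within_bounds: "0 \<le> hit_within a n x C" "hit_within a n x C \<le> 1"
  by (induction n arbitrary: x C) (auto intro: step_ge step_le)

lemma hit_within_self [simp]: "hit_within a n a C = 1"
  by (cases n) auto

lemma hit_within_mono: "hit_within a n x C \<le> hit_within a (Suc n) x C"
proof (induction n arbitrary: x C)
  case 0
  show ?case using hit_within_bounds(1)[of a "Suc 0" x C] by auto
next
  case (Suc n)
  have "step (hit_within a n) x C \<le> step (hit_within a (Suc n)) x C"
    by (rule step_mono) (rule Suc)+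
  then show ?case
    unfolding hit_within.simps(2)[of a "Suc n"] hit_within.simps(2)[of a n] by auto
qed

definition hit :: "int \<Rightarrow> int \<Rightarrow> int set \<Rightarrow> real" where
  "hit a x C = lim (\<lambda>n. hit_within a n x C)"

lemma hit_within_incseq: "incseq (\<lambda>n. hit_within a n x C)"
  by (intro incseq_SucI hit_within_mono)

lemma hit_within_tendsto: "(\<lambda>n. hit_within a n x C) \<longlonglongrightarrow> hit a x C"
proof -
  have "convergent (\<lambda>n. hit_within a n x C)"
    by (rule incseq_convergent[OF hit_within_incseq, of _ _ _ 1])
       (use hit_within_bounds in \<open>auto simp: convergent_def\<close>)
  then show ?thesis by (simp add: hit_def convergent_LIMSEQ_iff)
qed

lemma hit_within_le_hit: "hit_within a n x C \<le> hit a x C"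
  by (rule incseq_le[OF hit_within_incseq hit_within_tendsto])

lemma hit_bounds: "0 \<le> hit a x C" "hit a x C \<le> 1"
  using hit_within_bounds hit_within_le_hit order_trans
  by (blast, intro LIMSEQ_le_const2[OF hit_within_tendsto]) blast

lemma hit_self [simp]: "hit a a C = 1"
  using hit_within_tendsto[of a a C] by (simp add: LIMSEQ_const_iff)

lemma hit_step:
  assumes "x \<noteq> a" shows "step (hit a) x C = hit a x C"
proof (rule LIMSEQ_unique)
  show "(\<lambda>n. hit_within a (Suc n) x C) \<longlonglongrightarrow> hit a x C"
    by (rule LIMSEQ_Suc[OF hit_within_tendsto])
  show "(\<lambda>n. hit_within a (Suc n) x C) \<longlonglongrightarrow> step (hit a) x C"
    using assms by (simp add: tendsto_step hit_within_tendsto)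
qed

lemma hit_step_le: "step (hit a) x C \<le> hit a x C"
  by (cases "x = a") (auto simp: hit_step intro: step_le hit_bounds)

lemma hit_before_le_hit:
  assumes "a < b" "a \<le> x" shows "hit_before a b x C \<le> hit a x C"
proof (cases "x \<le> b")
  case True
  show ?thesis
  proof (rule comparison[where I = "\<lambda>_ _. True" and a = a and b = b and c = "\<lambda>_ _. 0"
        and f = "hit_before a b" and g = "hit a" and B = 1])
    show "hit_before a b x C - hit a x C \<le> 1" for x C
      using hit_before_bounds[of a b x C] hit_bounds[of a x C] by linarith
  qed (use assms True hit_before_step hit_step hit_bounds hit_before_right hit_before_bounds in auto)
next
  case False
  then show ?thesis using hit_bounds by (simp add: hit_before_right)
qed

text \<open>In \<open>n\<close> steps a nearest-neighbour walk cannot reach \<open>b\<close> from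
  \<open>x\<close>, so a hit of \<open>a\<close> within that time happens before
  \<open>b\<close>.\<close>

lemma hit_within_le_hit_before:
  "a \<le> x \<Longrightarrow> x + int n < b \<Longrightarrow> hit_within a n x C \<le> hit_before a b x C"
proof (induction n arbitrary: x C)
  case 0
  then show ?case using hit_before_bounds by (auto simp: hit_before_left)
next
  case (Suc n)
  show ?case
  proof (cases "x = a")
    case True
    then show ?thesis using Suc.prems by (simp add: hit_before_left)
  next
    case False
    have "step (hit_within a n) x C \<le> step (hit_before a b) x C"
      by (rule step_mono) (use Suc False in auto)
    then show ?thesis using False Suc.prems by (simp add: hit_before_step)
  qed
qed

text \<open>Squeezed between hitting within \<open>n\<close> steps and eventual hitting; the end
  \<open>x + 1 + int n\<close> is just out of reach in \<open>n\<close> steps. The limit transfers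
  monotonicity and locality from \<open>hit_before\<close> to \<open>hit\<close>.\<close>

lemma hit_before_tendsto:
  assumes "a \<le> x" shows "(\<lambda>n. hit_before a (x + 1 + int n) x C) \<longlonglongrightarrow> hit a x C"
proof (rule tendsto_sandwich[OF _ _ hit_within_tendsto tendsto_const])
  show "\<forall>\<^sub>F n in sequentially. hit_within a n x C \<le> hit_before a (x + 1 + int n) x C"
    using assms by (auto intro!: always_eventually hit_within_le_hit_before)
  show "\<forall>\<^sub>F n in sequentially. hit_before a (x + 1 + int n) x C \<le> hit a x C"
    using assms by (auto intro!: always_eventually hit_before_le_hit)
qed

lemma hit_consumed_mono:
  assumes "a \<le> x" "C \<subseteq> C'" shows "hit a x C \<le> hit a x C'"
  by (rule LIMSEQ_le[OF hit_before_tendsto[OF assms(1)] hit_before_tendsto[OF assms(1)]])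
     (use hit_before_consumed_mono[OF assms(2)] in auto)

lemma hit_local:
  assumes "a \<le> x" "C \<inter> {a<..} = C' \<inter> {a<..}" shows "hit a x C = hit a x C'"
proof -
  have "hit_before a (x + 1 + int n) x C = hit_before a (x + 1 + int n) x C'" for n
    using assms by (intro hit_before_local) auto
  then show ?thesis
    using hit_before_tendsto[OF assms(1), of C] hit_before_tendsto[OF assms(1), of C']
    by (auto intro: LIMSEQ_unique)
qed

lemma hit_nested: assumes "a \<le> c" "c \<le> x" shows "hit a x C \<le> hit c x C"
proof -
  have "hit_within a n x C \<le> hit_within c n x C" if "c \<le> x" for n x C
    using that
  proof (induction n arbitrary: x C)
    case 0
    then show ?case using assms by auto
  next
    case (Suc n)
    show ?case
    proof (cases "x = c")
      case True
      then show ?thesis using hit_within_bounds(2)[of a "Suc n" x C] by simp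
    next
      case False
      then have "step (hit_within a n) x C \<le> step (hit_within c n) x C"
        using Suc by (intro step_mono Suc.IH) auto
      then show ?thesis using False Suc.prems assms by auto
    qed
  qed
  then show ?thesis
    using assms by (intro LIMSEQ_le[OF hit_within_tendsto hit_within_tendsto]) auto
qed

text \<open>The walk may reach \<open>c\<close> first and then \<open>a\<close>. It arrives at
  \<open>c\<close> with an unknown consumed set, which by monotonicity only helps it to go on to
  \<open>a\<close>.\<close>

lemma hit_chain: assumes "a \<le> c" "c \<le> x" shows "hit a c {} * hit c x C \<le> hit a x C"
proof -
  have "hit a c {} * hit_before c (x + 1 + int n) x C \<le> hit a x C" for n
  proof (rule comparison[where I = "\<lambda>_ _. True" and a = c and b = "x + 1 + int n"
        and c = "\<lambda>_ _. 0" and B = 1 and g = "hit a"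
        and f = "\<lambda>y C. hit a c {} * hit_before c (x + 1 + int n) y C"])
    fix y :: int and C :: "int set" assume y: "c < y" "y < x + 1 + int n"
    show "hit a c {} * hit_before c (x + 1 + int n) y C - hit a y C \<le> 1"
      using hit_bounds[of a y C] hit_bounds[of a c "{}"] hit_before_bounds[of c "x + 1 + int n" y C]
      by (smt (verit) mult_left_le)
    show "hit a c {} * hit_before c (x + 1 + int n) y C \<le>
        0 + step (\<lambda>y C. hit a c {} * hit_before c (x + 1 + int n) y C) y C"
      using y by (simp add: step_cmult hit_before_step)
    show "0 + step (hit a) y C \<le> hit a y C" by (simp add: hit_step_le)
  qed (use assms hit_consumed_mono[of a c "{}"] hit_bounds in
      \<open>auto simp: hit_before_left hit_before_right\<close>)
  moreover have "(\<lambda>n. hit a c {} * hit_before c (x + 1 + int n) x C) \<longlonglongrightarrow> hit a c {} * hit c x C"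
    by (intro tendsto_intros hit_before_tendsto assms)
  ultimately show ?thesis by (intro LIMSEQ_le_const2) auto
qed

text \<open>The drift is never to the left, so \<open>(x - d) / (a - d)\<close> is subharmonic and a
  lower bound for reaching \<open>a\<close>; it tends to 1 as \<open>d\<close> decreases to
  \<open>-\<infinity>\<close>.\<close>

lemma hit_from_left: assumes "x \<le> a" shows "hit a x C = 1"
proof -
  have *: "real_of_int (x - d) / real_of_int (a - d) \<le> hit a x C" if "d < x" for d
  proof (rule comparison[where I = "\<lambda>_ _. True" and a = d and b = a
        and c = "\<lambda>_ _. 0" and B = 1 and g = "hit a"
        and f = "\<lambda>x C. real_of_int (x - d) / real_of_int (a - d)"])
    fix x :: int and C :: "int set" assume x: "d < x" "x < a"
    have "real_of_int (x - d) / real_of_int (a - d) \<le> 1" using x by (simp add: divide_simps)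
    then show "real_of_int (x - d) / real_of_int (a - d) - hit a x C \<le> 1"
      using hit_bounds[of a x C] by linarith
    have "step (\<lambda>x C. real_of_int (x - d) / real_of_int (a - d)) x C =
        real_of_int (x - d) / real_of_int (a - d) + (2 * rp x C - 1) / real_of_int (a - d)"
      using x by (simp add: step_def field_simps)
    moreover have "0 \<le> (2 * rp x C - 1) / real_of_int (a - d)"
      using rp_bounds[of x C] x by (intro divide_nonneg_nonneg) auto
    ultimately show "real_of_int (x - d) / real_of_int (a - d) \<le>
        0 + step (\<lambda>x C. real_of_int (x - d) / real_of_int (a - d)) x C" by simp
    show "0 + step (hit a) x C \<le> hit a x C" by (simp add: hit_step_le)
  qed (use that assms hit_bounds in auto)
  have lim: "(\<lambda>n. (1 + real n) / (real_of_int (a - x) + 1 + real n)) \<longlonglongrightarrow> 1"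
    by real_asymp
  have "1 \<le> hit a x C"
  proof (rule LIMSEQ_le_const2[OF lim], intro exI allI impI)
    fix n
    show "(1 + real n) / (real_of_int (a - x) + 1 + real n) \<le> hit a x C"
      using *[of "x - 1 - int n"] by (simp add: algebra_simps)
  qed
  with hit_bounds[of a x C] show ?thesis by simp
qed

section \<open>Return probabilities in the fresh environment\<close>

text \<open>The probability to step below \<open>z\<close> eventually, starting at \<open>z\<close> in the fresh environment.\<close>

abbreviation return_prob :: "int \<Rightarrow> real" where
  "return_prob z \<equiv> hit (z - 1) z {}"

text \<open>After a step to the right the walk has at least to come back from \<open>z + 1\<close>
  to \<open>z\<close>. Consequently a positive escape probability propagates to the left.\<close>

lemma return_prob_le: "return_prob z \<le> 1 - \<omega> z * (1 - return_prob (z + 1))"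
proof -
  have "return_prob z = \<omega> z * hit (z - 1) (z + 1) {} + (1 - \<omega> z)"
    using hit_step[of z "z - 1" "{}"] by (simp add: step_def rp_def)
  also have "\<dots> \<le> \<omega> z * hit z (z + 1) {} + (1 - \<omega> z)"
    using half_le[of z] by (intro add_mono mult_left_mono hit_nested) auto
  finally show ?thesis by (simp add: algebra_simps)
qed

lemma return_prob_less: "return_prob (z + 1) < 1 \<Longrightarrow> return_prob z < 1"
  using return_prob_le[of z] half_le[of z] by (smt (verit) mult_pos_pos field_sum_of_halves)

lemma return_prob_less_left: "return_prob (z + int n) < 1 \<Longrightarrow> return_prob z < 1"
proof (induction n)
  case (Suc n)
  then show ?case using return_prob_less[of "z + int n"] by (simp add: algebra_simps)
qed simp

text \<open>A descent to \<open>a\<close> is composed of descents by one site, each certain in the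
  fresh environment and, by monotonicity, in every other.\<close>

lemma hit_eq_1:
  assumes "\<And>z. return_prob z = 1" shows "hit a x C = 1"
proof (cases "x \<le> a")
  case False
  have "hit a (a + int n) {} = 1" for n
  proof (induction n)
    case (Suc n)
    have "hit a (a + int n) {} * hit (a + int n) (a + int (Suc n)) {} \<le> hit a (a + int (Suc n)) {}"
      by (rule hit_chain) auto
    with Suc assms[of "a + int (Suc n)"] hit_bounds[of a "a + int (Suc n)" "{}"]
    show ?case by (simp add: algebra_simps)
  qed simp
  from this[of "nat (x - a)"] have "hit a x {} = 1" using False by simp
  then show ?thesis using hit_consumed_mono[of a x "{}" C] hit_bounds[of a x C] False by simp
qed (rule hit_from_left)

section \<open>The walk on path space\<close>

lemma funpow_step_tendsto:
  assumes "\<And>x C. (\<lambda>n. f n x C) \<longlonglongrightarrow> g x C"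
  shows "(\<lambda>n. (step ^^ i) (f n) x C) \<longlonglongrightarrow> (step ^^ i) g x C"
  by (induction i arbitrary: x C) (auto intro: assms tendsto_step)

lemma funpow_step_hit_nonneg: "0 \<le> (step ^^ i) (hit a) x C"
  by (induction i arbitrary: x C) (auto intro: hit_bounds step_ge)

lemma funpow_step_hit_decseq: "decseq (\<lambda>i. (step ^^ i) (hit a) x C)"
proof -
  have "(step ^^ Suc i) (hit a) x C \<le> (step ^^ i) (hit a) x C" for i
  proof (induction i arbitrary: x C)
    case 0
    show ?case by (simp add: hit_step_le)
  next
    case (Suc i)
    have "step ((step ^^ Suc i) (hit a)) x C \<le> step ((step ^^ i) (hit a)) x C"
      by (rule step_mono) (rule Suc)+
    then show ?case by simp
  qed
  then show ?thesis by (rule decseq_SucI)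
qed

section \<open>Infinitely many visits as a function of the state\<close>

text \<open>
  \<open>(step ^^ i) (hit a)\<close> is the probability to be at \<open>a\<close> at some time \<open>\<ge> i\<close>.
\<close>

definition hit_inf_often :: "int \<Rightarrow> int \<Rightarrow> int set \<Rightarrow> real" where
  "hit_inf_often a x C = lim (\<lambda>i. (step ^^ i) (hit a) x C)"

lemma hit_inf_often_tendsto: "(\<lambda>i. (step ^^ i) (hit a) x C) \<longlonglongrightarrow> hit_inf_often a x C"
proof -
  have "convergent (\<lambda>i. (step ^^ i) (hit a) x C)"
    by (rule decseq_convergent[OF funpow_step_hit_decseq, of 0])
       (auto simp: convergent_def funpow_step_hit_nonneg)
  then show ?thesis by (simp add: hit_inf_often_def convergent_LIMSEQ_iff)
qed

lemma hit_inf_often_nonneg: "0 \<le> hit_inf_often a x C"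
  by (rule LIMSEQ_le_const[OF hit_inf_often_tendsto])
     (auto simp: funpow_step_hit_nonneg)

lemma hit_inf_often_le_hit: "hit_inf_often a x C \<le> hit a x C"
  using decseq_ge[OF funpow_step_hit_decseq hit_inf_often_tendsto, of a x C 0] by simp

lemma hit_inf_often_le_1: "hit_inf_often a x C \<le> 1"
  using hit_inf_often_le_hit hit_bounds(2) by (rule order_trans)

lemma hit_inf_often_step: "step (hit_inf_often a) x C = hit_inf_often a x C"
proof (rule LIMSEQ_unique)
  show "(\<lambda>i. (step ^^ Suc i) (hit a) x C) \<longlonglongrightarrow> hit_inf_often a x C"
    by (rule LIMSEQ_Suc[OF hit_inf_often_tendsto])
  show "(\<lambda>i. (step ^^ Suc i) (hit a) x C) \<longlonglongrightarrow> step (hit_inf_often a) x C"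
    by (simp add: tendsto_step hit_inf_often_tendsto)
qed

text \<open>
  The walk almost surely reaches a new maximum, where no site ahead is consumed; so a bound on
  \<open>hit_inf_often\<close> in such states is a bound everywhere, and it improves by the factor
  \<open>return_prob\<close> since the walk has to return from there.
\<close>

lemma hit_inf_often_le_fresh:
  assumes g: "0 \<le> g" "\<And>y C. a < y \<Longrightarrow> C \<subseteq> {..<y} \<Longrightarrow> hit_inf_often a y C \<le> g"
    and C: "C \<subseteq> {..<M}"
  shows "hit_inf_often a x C \<le> g"
proof -
  \<comment> \<open>At \<open>b\<close> every consumed site lies below and \<open>a < b\<close>, so
    the bound \<open>g\<close> applies there.\<close>
  define b where "b = max M (max (a + 1) x)"
  have b: "C \<subseteq> {..<b}" "a < b" "x \<le> b" using C by (auto simp: b_def)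
  \<comment> \<open>As the drift is never to the left, the linear term dominates the probability of
    reaching \<open>d\<close> before \<open>b\<close>. It vanishes as \<open>d\<close> decreases to
    \<open>-\<infinity>\<close>.\<close>
  have *: "hit_inf_often a x C \<le> g + real_of_int (b - x) / real_of_int (b - d)" if "d < x" for d
  proof (rule comparison[where I = "\<lambda>x C. C \<subseteq> {..<b}" and a = d and b = b
        and c = "\<lambda>_ _. 0" and B = 1 and f = "hit_inf_often a"
        and g = "\<lambda>x C. g + real_of_int (b - x) / real_of_int (b - d)"])
    fix x :: int and C :: "int set" assume x: "d < x" "x < b"
    have "0 \<le> real_of_int (b - x) / real_of_int (b - d)" using x by simp
    then show "hit_inf_often a x C - (g + real_of_int (b - x) / real_of_int (b - d)) \<le> 1"
      using hit_inf_often_le_1[of a x C] g(1) by linarith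
    have "step (\<lambda>x C. g + real_of_int (b - x) / real_of_int (b - d)) x C =
        g + real_of_int (b - x) / real_of_int (b - d) - (2 * rp x C - 1) / real_of_int (b - d)"
      using x by (simp add: step_def field_simps)
    moreover have "0 \<le> (2 * rp x C - 1) / real_of_int (b - d)"
      using rp_bounds[of x C] x by (intro divide_nonneg_nonneg) auto
    ultimately show "0 + step (\<lambda>x C. g + real_of_int (b - x) / real_of_int (b - d)) x C
        \<le> g + real_of_int (b - x) / real_of_int (b - d)" by simp
    show "hit_inf_often a x C \<le> 0 + step (hit_inf_often a) x C" by (simp add: hit_inf_often_step)
    show "C \<subseteq> {..<b} \<Longrightarrow> C \<subseteq> {..<b} \<and> insert x C \<subseteq> {..<b}" using x by auto
  next
    fix C :: "int set"
    have "d < b" using that b by simp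
    then show "hit_inf_often a d C \<le> g + real_of_int (b - d) / real_of_int (b - d)"
      using hit_inf_often_le_1[of a d C] g(1) by simp
  qed (use that b g in auto)
  have lim: "(\<lambda>n. g + real_of_int (b - x) / (real_of_int (b - x) + 1 + real n)) \<longlonglongrightarrow> g"
    by real_asymp
  show ?thesis
  proof (rule LIMSEQ_le_const[OF lim], intro exI allI impI)
    fix n
    show "hit_inf_often a x C \<le> g + real_of_int (b - x) / (real_of_int (b - x) + 1 + real n)"
      using *[of "x - 1 - int n"] by (simp add: algebra_simps)
  qed
qed

lemma hit_inf_often_fresh:
  assumes g: "0 \<le> g" "\<And>y C. a < y \<Longrightarrow> C \<subseteq> {..<y} \<Longrightarrow> hit_inf_often a y C \<le> g"
    and y: "a < y" "C \<subseteq> {..<y}"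
  shows "hit_inf_often a y C \<le> g * return_prob y"
proof -
  \<comment> \<open>The right-hand side is the probability of reaching \<open>y - 1\<close> only
    after \<open>y + 1 + int n\<close>; it tends to 0. At the lower end the bound \<open>g\<close>
    applies, and from the upper end the walk has to pass \<open>y - 1\<close> on its way to
    \<open>a\<close>.\<close>
  have *: "hit_inf_often a y C - g * hit (y - 1) y C \<le>
      hit (y - 1) y C - hit_before (y - 1) (y + 1 + int n) y C" for n
  proof (rule comparison[where I = "\<lambda>x C. \<exists>M. C \<subseteq> {..<M}" and a = "y - 1" and b = "y + 1 + int n"
        and c = "\<lambda>_ _. 0" and B = 1
        and f = "\<lambda>x C. hit_inf_often a x C - g * hit (y - 1) x C"
        and g = "\<lambda>x C. hit (y - 1) x C - hit_before (y - 1) (y + 1 + int n) x C"])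
    fix x :: int and C :: "int set" assume x: "y - 1 < x" "x < y + 1 + int n"
    have "0 \<le> g * hit (y - 1) x C" using g(1) hit_bounds by simp
    moreover have "hit_before (y - 1) (y + 1 + int n) x C \<le> hit (y - 1) x C"
      using x by (intro hit_before_le_hit) auto
    ultimately show "hit_inf_often a x C - g * hit (y - 1) x C -
        (hit (y - 1) x C - hit_before (y - 1) (y + 1 + int n) x C) \<le> 1"
      using hit_inf_often_le_1[of a x C] by linarith
    show "\<exists>M. C \<subseteq> {..<M} \<Longrightarrow> (\<exists>M. C \<subseteq> {..<M}) \<and> (\<exists>M. insert x C \<subseteq> {..<M})"
    proof -
      assume "\<exists>M. C \<subseteq> {..<M}"
      then obtain M where "C \<subseteq> {..<M}" by blast
      then have "insert x C \<subseteq> {..<max M (x + 1)}" by auto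
      with \<open>C \<subseteq> {..<M}\<close> show ?thesis by blast
    qed
    show "hit_inf_often a x C - g * hit (y - 1) x C \<le>
        0 + step (\<lambda>x C. hit_inf_often a x C - g * hit (y - 1) x C) x C"
      using x by (simp add: step_diff step_cmult hit_inf_often_step hit_step)
    show "0 + step (\<lambda>x C. hit (y - 1) x C - hit_before (y - 1) (y + 1 + int n) x C) x C \<le>
        hit (y - 1) x C - hit_before (y - 1) (y + 1 + int n) x C"
      using x by (simp add: step_diff hit_before_step hit_step)
  next
    fix C :: "int set" assume "\<exists>M. C \<subseteq> {..<M}"
    then obtain M where "C \<subseteq> {..<M}" by blast
    have "hit_inf_often a (y - 1) C \<le> g"
      by (rule hit_inf_often_le_fresh[OF g(1) _ \<open>C \<subseteq> {..<M}\<close>], rule g(2))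
    then show "hit_inf_often a (y - 1) C - g * hit (y - 1) (y - 1) C \<le>
        hit (y - 1) (y - 1) C - hit_before (y - 1) (y + 1 + int n) (y - 1) C"
      by (simp add: hit_before_left)
  next
    fix C :: "int set"
    let ?b = "y + 1 + int n"
    have "hit_inf_often a ?b C \<le> hit a ?b C" by (rule hit_inf_often_le_hit)
    also have "\<dots> \<le> hit (y - 1) ?b C" using y by (intro hit_nested) auto
    finally have "hit_inf_often a ?b C \<le> hit (y - 1) ?b C" .
    moreover have "0 \<le> g * hit (y - 1) ?b C" using g(1) hit_bounds by simp
    ultimately show "hit_inf_often a ?b C - g * hit (y - 1) ?b C \<le>
        hit (y - 1) ?b C - hit_before (y - 1) ?b ?b C"
      by (simp add: hit_before_right)
  qed (use y in auto)
  have "(\<lambda>n. hit (y - 1) y C - hit_before (y - 1) (y + 1 + int n) y C)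
      \<longlonglongrightarrow> hit (y - 1) y C - hit (y - 1) y C"
    by (intro tendsto_intros hit_before_tendsto) auto
  then have "hit_inf_often a y C - g * hit (y - 1) y C \<le> hit (y - 1) y C - hit (y - 1) y C"
    by (rule LIMSEQ_le_const) (use * in blast)
  moreover have "hit (y - 1) y C = return_prob y"
    using y by (intro hit_local) auto
  ultimately show ?thesis by simp
qed

text \<open>Each application of \<open>hit_inf_often_fresh\<close> improves the bound on fresh
  states by the factor \<open>r\<close>, so \<open>r ^ n\<close> is a bound for every
  \<open>n\<close>.\<close>

lemma hit_inf_often_eq_0:
  assumes r: "r < 1" "\<And>z. return_prob z \<le> r"
  shows "hit_inf_often a x {} = 0"
proof -
  have r0: "0 \<le> r" using r(2)[of 0] hit_bounds(1)[of "0 - 1" 0 "{}"] by linarith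
  have fresh: "hit_inf_often a y C \<le> r ^ n" if "a < y" "C \<subseteq> {..<y}" for n y C
    using that
  proof (induction n arbitrary: y C)
    case 0
    then show ?case by (simp add: hit_inf_often_le_1)
  next
    case (Suc n)
    have "hit_inf_often a y C \<le> r ^ n * return_prob y"
      using r0 by (intro hit_inf_often_fresh Suc) auto
    also have "\<dots> \<le> r ^ n * r" using r r0 by (intro mult_left_mono) auto
    finally show ?case by (simp add: mult.commute)
  qed
  have "hit_inf_often a x {} \<le> r ^ n" for n
    by (rule hit_inf_often_le_fresh[of _ _ _ 0]) (use r0 fresh in auto)
  moreover have "(\<lambda>n. r ^ n) \<longlonglongrightarrow> 0" using r r0 by (intro LIMSEQ_power_zero) auto
  ultimately have "hit_inf_often a x {} \<le> 0" by (intro LIMSEQ_le_const) auto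
  with hit_inf_often_nonneg[of a x "{}"] show ?thesis by simp
qed

section \<open>Path events of the law in terms of the transition operator\<close>

definition consumed :: "(nat \<Rightarrow> int) \<Rightarrow> nat \<Rightarrow> int set" where
  "consumed X n = {z. \<exists>k<n. X k = z \<and> X (Suc k) = z - 1}"

lemma right_prob_eq: "right_prob \<omega> X n = rp (X n) (consumed X n)"
  by (simp add: right_prob_def rp_def consumed_def jumped_left_before_def)

lemma consumed_0 [simp]: "consumed X 0 = {}"
  by (simp add: consumed_def)

lemma consumed_Suc:
  shows consumed_right: "consumed (h(Suc n := h n + 1)) (Suc n) = consumed h n"
    and consumed_left: "consumed (h(Suc n := h n - 1)) (Suc n) = insert (h n) (consumed h n)"
proof -
  have "(\<exists>k<Suc n. (h(Suc n := v)) k = z \<and> (h(Suc n := v)) (Suc k) = z - 1) \<longleftrightarrow>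
      (\<exists>k<n. h k = z \<and> h (Suc k) = z - 1) \<or> (h n = z \<and> v = z - 1)" for z v
    by (simp only: Ex_less_Suc) (auto cong: conj_cong)
  then show "consumed (h(Suc n := h n + 1)) (Suc n) = consumed h n"
    "consumed (h(Suc n := h n - 1)) (Suc n) = insert (h n) (consumed h n)"
    unfolding consumed_def by auto
qed

lemma pred_eventually_hit [measurable]:
  "Measurable.pred (cookie_law \<omega> y) (\<lambda>X. \<exists>m\<in>{i..j}. X m = a)"
  "Measurable.pred (cookie_law \<omega> y) (\<lambda>X. \<exists>m\<ge>i. X m = a)"
  "Measurable.pred (cookie_law \<omega> y) (\<lambda>X. \<forall>i\<le>n. X i = h i)"
  by measurable

lemma measure_cylinder_Suc:
  "\<P>(X in cookie_law \<omega> y. \<forall>i\<le>Suc n. X i = (h(Suc n := h n + 1)) i) =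
     \<P>(X in cookie_law \<omega> y. \<forall>i\<le>n. X i = h i) * rp (h n) (consumed h n)"
  "\<P>(X in cookie_law \<omega> y. \<forall>i\<le>Suc n. X i = (h(Suc n := h n - 1)) i) =
     \<P>(X in cookie_law \<omega> y. \<forall>i\<le>n. X i = h i) * (1 - rp (h n) (consumed h n))"
proof -
  have *: "(\<forall>i\<le>Suc n. X i = (h(Suc n := v)) i) \<longleftrightarrow> (\<forall>i\<le>n. X i = h i) \<and> X (Suc n) = v"
    for X :: "nat \<Rightarrow> int" and v
    by (auto simp: le_Suc_eq)
  have w: "0 \<le> \<omega> (h n)" "\<omega> (h n) \<le> 1" using half_le[of "h n"] less_1[of "h n"] by auto
  show "\<P>(X in cookie_law \<omega> y. \<forall>i\<le>Suc n. X i = (h(Suc n := h n + 1)) i) =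
     \<P>(X in cookie_law \<omega> y. \<forall>i\<le>n. X i = h i) * rp (h n) (consumed h n)"
    unfolding * using measure_cookie_law_right[of \<omega> h n y] w by (simp add: right_prob_eq)
  show "\<P>(X in cookie_law \<omega> y. \<forall>i\<le>Suc n. X i = (h(Suc n := h n - 1)) i) =
     \<P>(X in cookie_law \<omega> y. \<forall>i\<le>n. X i = h i) * (1 - rp (h n) (consumed h n))"
    unfolding * using measure_cookie_law_left[of \<omega> h n y] w by (simp add: right_prob_eq)
qed

text \<open>The two cylinders that continue by a unit step already carry the whole probability of
  the given one, so all other continuations are null.\<close>

lemma measure_split_step:
  assumes [measurable]: "Measurable.pred (cookie_law \<omega> y) A"
  shows "\<P>(X in cookie_law \<omega> y. (\<forall>i\<le>n. X i = h i) \<and> A X) =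
    \<P>(X in cookie_law \<omega> y. (\<forall>i\<le>Suc n. X i = (h(Suc n := h n + 1)) i) \<and> A X) +
    \<P>(X in cookie_law \<omega> y. (\<forall>i\<le>Suc n. X i = (h(Suc n := h n - 1)) i) \<and> A X)"
proof -
  let ?M = "cookie_law \<omega> y"
  define E where "E = {X \<in> space ?M. \<forall>i\<le>n. X i = h i}"
  define R where "R = {X \<in> space ?M. \<forall>i\<le>Suc n. X i = (h(Suc n := h n + 1)) i}"
  define L where "L = {X \<in> space ?M. \<forall>i\<le>Suc n. X i = (h(Suc n := h n - 1)) i}"
  define S where "S = {X \<in> space ?M. A X}"
  have meas: "E \<in> sets ?M" "R \<in> sets ?M" "L \<in> sets ?M" "S \<in> sets ?M"
    unfolding E_def R_def L_def S_def by measurable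
  have RL: "R \<inter> L = {}" by (auto simp: R_def L_def)
  have "R \<subseteq> E" "L \<subseteq> E" by (auto simp: R_def L_def E_def)
  then have RLE: "R \<union> L \<subseteq> E" by blast
  have "measure ?M (R \<union> L) = measure ?M R + measure ?M L"
    using meas RL by (intro cookie_law.finite_measure_Union)
  also have "\<dots> = measure ?M E"
    using measure_cylinder_Suc[of y n h] by (simp add: R_def L_def E_def algebra_simps)
  finally have "measure ?M (E - (R \<union> L)) = 0"
    using meas RLE by (simp add: cookie_law.finite_measure_Diff)
  then have 0: "measure ?M (S \<inter> (E - (R \<union> L))) = 0"
    using meas cookie_law.finite_measure_mono[of "S \<inter> (E - (R \<union> L))" "E - (R \<union> L)" \<omega> y]
      measure_nonneg[of ?M "S \<inter> (E - (R \<union> L))"] by (auto intro!: antisym)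
  have "E \<inter> S = (S \<inter> (E - (R \<union> L))) \<union> ((R \<inter> S) \<union> (L \<inter> S))"
    using RLE by auto
  then have "measure ?M (E \<inter> S) = measure ?M (S \<inter> (E - (R \<union> L))) + measure ?M ((R \<inter> S) \<union> (L \<inter> S))"
    using meas by (simp only:) (rule cookie_law.finite_measure_Union, auto)
  also have "measure ?M ((R \<inter> S) \<union> (L \<inter> S)) = measure ?M (R \<inter> S) + measure ?M (L \<inter> S)"
    using meas RL by (intro cookie_law.finite_measure_Union) auto
  finally have "measure ?M (E \<inter> S) = measure ?M (R \<inter> S) + measure ?M (L \<inter> S)" by (simp add: 0)
  moreover have "E \<inter> S = {X \<in> space ?M. (\<forall>i\<le>n. X i = h i) \<and> A X}"
    "R \<inter> S = {X \<in> space ?M. (\<forall>i\<le>Suc n. X i = (h(Suc n := h n + 1)) i) \<and> A X}"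
    "L \<inter> S = {X \<in> space ?M. (\<forall>i\<le>Suc n. X i = (h(Suc n := h n - 1)) i) \<and> A X}"
    by (auto simp: E_def R_def L_def S_def)
  ultimately show ?thesis by simp
qed

text \<open>This is the Markov property: given a cylinder, the future depends only on its last
  position and its consumed set. The induction extends the cylinder by one step in either
  direction.\<close>

lemma measure_hit_from_cylinder:
  "\<P>(X in cookie_law \<omega> y. (\<forall>i\<le>n. X i = h i) \<and> (\<exists>m\<in>{n..n + k}. X m = a)) =
   \<P>(X in cookie_law \<omega> y. \<forall>i\<le>n. X i = h i) * hit_within a k (h n) (consumed h n)"
proof (induction k arbitrary: n h)
  case 0
  have "(\<forall>i\<le>n. X i = h i) \<and> (\<exists>m\<in>{n..n + 0}. X m = a) \<longleftrightarrow> (\<forall>i\<le>n. X i = h i) \<and> h n = a"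
    for X by auto
  then show ?case by auto
next
  case (Suc k)
  show ?case
  proof (cases "h n = a")
    case True
    then have "(\<forall>i\<le>n. X i = h i) \<and> (\<exists>m\<in>{n..n + Suc k}. X m = a) \<longleftrightarrow> (\<forall>i\<le>n. X i = h i)" for X
      by (auto intro!: bexI[of _ n])
    with True show ?thesis by simp
  next
    case False
    have ev: "(\<forall>i\<le>n. X i = h i) \<and> (\<exists>m\<in>{n..n + Suc k}. X m = a) \<longleftrightarrow>
        (\<forall>i\<le>n. X i = h i) \<and> (\<exists>m\<in>{Suc n..Suc n + k}. X m = a)" for X
    proof -
      have "X m \<noteq> a" if "\<forall>i\<le>n. X i = h i" "m = n" for m using that False by simp
      moreover have "m \<in> {n..n + Suc k} \<longleftrightarrow> m = n \<or> m \<in> {Suc n..Suc n + k}" for m by auto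
      ultimately show ?thesis by blast
    qed
    have "\<P>(X in cookie_law \<omega> y. (\<forall>i\<le>n. X i = h i) \<and> (\<exists>m\<in>{n..n + Suc k}. X m = a)) =
        \<P>(X in cookie_law \<omega> y. (\<forall>i\<le>n. X i = h i) \<and> (\<exists>m\<in>{Suc n..Suc n + k}. X m = a))"
      unfolding ev ..
    also have "\<dots> = \<P>(X in cookie_law \<omega> y. \<forall>i\<le>n. X i = h i) *
        step (hit_within a k) (h n) (consumed h n)"
      by (rule trans[OF measure_split_step[OF pred_eventually_hit(1)]], simp only: Suc.IH
          measure_cylinder_Suc fun_upd_same consumed_Suc)
         (simp add: step_def[of "hit_within a k"] algebra_simps)
    finally show ?thesis using False by simp
  qed
qed

lemma measure_hit_later_from_cylinder:
  "\<P>(X in cookie_law \<omega> y. (\<forall>i\<le>n. X i = h i) \<and> (\<exists>m\<in>{n + i..n + i + k}. X m = a)) =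
   \<P>(X in cookie_law \<omega> y. \<forall>i\<le>n. X i = h i) * (step ^^ i) (hit_within a k) (h n) (consumed h n)"
proof (induction i arbitrary: n h)
  case 0
  then show ?case using measure_hit_from_cylinder by simp
next
  case (Suc i)
  have IH: "\<P>(X in cookie_law \<omega> y. (\<forall>j\<le>Suc n. X j = h j) \<and> (\<exists>m\<in>{n + Suc i..n + Suc i + k}. X m = a)) =
   \<P>(X in cookie_law \<omega> y. \<forall>j\<le>Suc n. X j = h j) *
     (step ^^ i) (hit_within a k) (h (Suc n)) (consumed h (Suc n))" for h
    using Suc[of "Suc n" h] by simp
  show ?case
    by (rule trans[OF measure_split_step[OF pred_eventually_hit(1)]], simp only: IH
        measure_cylinder_Suc fun_upd_same consumed_Suc)
       (simp add: step_def[of "(step ^^ i) (hit_within a k)"] algebra_simps)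
qed

lemma measure_hit_within:
  "\<P>(X in cookie_law \<omega> y. \<exists>m\<in>{i..i + k}. X m = a) = (step ^^ i) (hit_within a k) y {}"
proof -
  have "\<P>(X in cookie_law \<omega> y. X 0 = y) = 1" by (rule measure_cookie_law_0)
  then have "AE X in cookie_law \<omega> y. X 0 = y"
    by (subst (asm) cookie_law.prob_Collect_eq_1) measurable
  then have "\<P>(X in cookie_law \<omega> y. \<exists>m\<in>{i..i + k}. X m = a) =
      \<P>(X in cookie_law \<omega> y. (\<forall>i\<le>0. X i = y) \<and> (\<exists>m\<in>{i..i + k}. X m = a))"
  proof (intro cookie_law.prob_eq_AE)
    assume "AE X in cookie_law \<omega> y. X 0 = y"
    then show "AE X in cookie_law \<omega> y. (\<exists>m\<in>{i..i + k}. X m = a) \<longleftrightarrow>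
        (\<forall>i\<le>0. X i = y) \<and> (\<exists>m\<in>{i..i + k}. X m = a)"
      by (auto elim!: eventually_mono)
  qed measurable
  also have "\<dots> = (step ^^ i) (hit_within a k) y {}"
    using measure_hit_later_from_cylinder[of y 0 "\<lambda>_. y" i k a] measure_cookie_law_0[of \<omega> y] by simp
  finally show ?thesis .
qed

lemma measure_hit_later:
  "\<P>(X in cookie_law \<omega> y. \<exists>m\<ge>i. X m = a) = (step ^^ i) (hit a) y {}"
proof (rule LIMSEQ_unique)
  let ?E = "\<lambda>k. {X \<in> space (cookie_law \<omega> y). \<exists>m\<in>{i..i + k}. X m = a}"
  have "(\<lambda>k. measure (cookie_law \<omega> y) (?E k)) \<longlonglongrightarrow> measure (cookie_law \<omega> y) (\<Union>k. ?E k)"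
  proof (rule cookie_law.finite_Lim_measure_incseq)
    have "?E k \<in> sets (cookie_law \<omega> y)" for k by measurable
    then show "range ?E \<subseteq> sets (cookie_law \<omega> y)" by blast
    show "incseq ?E" by (force simp: incseq_def)
  qed
  also have "(\<Union>k. ?E k) = {X \<in> space (cookie_law \<omega> y). \<exists>m\<ge>i. X m = a}"
  proof (intro set_eqI iffI)
    fix X assume "X \<in> {X \<in> space (cookie_law \<omega> y). \<exists>m\<ge>i. X m = a}"
    then obtain m where "i \<le> m" "X m = a" by auto
    then have "X \<in> ?E (m - i)" by (auto intro!: bexI[of _ m])
    then show "X \<in> (\<Union>k. ?E k)" by blast
  qed auto
  finally show "(\<lambda>k. (step ^^ i) (hit_within a k) y {}) \<longlonglongrightarrow>
      \<P>(X in cookie_law \<omega> y. \<exists>m\<ge>i. X m = a)"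
    unfolding measure_hit_within .
  show "(\<lambda>k. (step ^^ i) (hit_within a k) y {}) \<longlonglongrightarrow> (step ^^ i) (hit a) y {}"
    by (intro funpow_step_tendsto hit_within_tendsto)
qed

lemma measure_hit_inf_often:
  "\<P>(X in cookie_law \<omega> y. \<exists>\<^sub>\<infinity>n. X n = a) = hit_inf_often a y {}"
proof (rule LIMSEQ_unique)
  let ?E = "\<lambda>i. {X \<in> space (cookie_law \<omega> y). \<exists>m\<ge>i. X m = a}"
  have "(\<lambda>i. measure (cookie_law \<omega> y) (?E i)) \<longlonglongrightarrow> measure (cookie_law \<omega> y) (\<Inter>i. ?E i)"
  proof (rule cookie_law.finite_Lim_measure_decseq)
    have "?E k \<in> sets (cookie_law \<omega> y)" for k by measurable
    then show "range ?E \<subseteq> sets (cookie_law \<omega> y)" by blast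
    show "decseq ?E" by (auto simp: decseq_def intro: order_trans)
  qed
  also have "(\<Inter>i. ?E i) = {X \<in> space (cookie_law \<omega> y). \<exists>\<^sub>\<infinity>n. X n = a}"
    by (auto simp: INFM_nat_le)
  finally show "(\<lambda>i. (step ^^ i) (hit a) y {}) \<longlonglongrightarrow> \<P>(X in cookie_law \<omega> y. \<exists>\<^sub>\<infinity>n. X n = a)"
    unfolding measure_hit_later .
qed (rule hit_inf_often_tendsto)

lemma measure_hitting_time_infinity:
  "\<P>(X in cookie_law \<omega> y. hitting_time a X = \<infinity>) = 1 - hit a y {}"
proof -
  have "\<P>(X in cookie_law \<omega> y. \<not> (\<exists>m\<ge>0. X m = a)) = 1 - \<P>(X in cookie_law \<omega> y. \<exists>m\<ge>0. X m = a)"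
    by (rule cookie_law.prob_neg) measurable
  then show ?thesis
    using measure_hit_later[of y 0 a] by (simp add: hitting_time_eq_infinity_iff)
qed

section \<open>Criteria by return probabilities\<close>

lemma recurrentI:
  assumes "\<And>z. return_prob z = 1" shows "recurrent \<omega>"
proof -
  have "hit a = (\<lambda>x C. 1)" for a using hit_eq_1[OF assms] by (intro ext)
  moreover have "(step ^^ i) (\<lambda>x C. 1) = (\<lambda>x C. 1)" for i
    by (induction i) (auto intro!: ext)
  ultimately have "hit_inf_often a y {} = 1" for a y
    using hit_inf_often_tendsto[of a y "{}"] by (simp add: LIMSEQ_const_iff)
  then show ?thesis unfolding recurrent_def measure_hit_inf_often by simp
qed

lemma transientI:
  assumes "r < 1" "\<And>z. return_prob z \<le> r" shows "transient \<omega>"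
  unfolding transient_def measure_hit_inf_often using hit_inf_often_eq_0[OF assms] by simp

end

section \<open>Periodic environments\<close>

locale periodic_cookie_environment = cookie_environment +
  fixes N :: nat
  assumes N: "0 < N" and periodic: "\<omega> (x + int N) = \<omega> x"
begin

section \<open>Invariance under translation by a period\<close>

lemma hit_within_periodic:
  "hit_within (a + int N) n (x + int N) ((+) (int N) ` C) = hit_within a n x C"
proof (induction n arbitrary: x C)
  case (Suc n)
  have "rp (x + int N) ((+) (int N) ` C) = rp x C"
    by (auto simp: rp_def periodic image_iff add.commute)
  moreover have "insert (x + int N) ((+) (int N) ` C) = (+) (int N) ` insert x C"
    by (simp add: add.commute)
  ultimately have "step (hit_within (a + int N) n) (x + int N) ((+) (int N) ` C) =
      step (hit_within a n) x C"
    using Suc[of "x + 1" C] Suc[of "x - 1" "insert x C"]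
    by (simp add: step_def algebra_simps)
  then show ?case by simp
qed simp

lemma return_within_periodic:
  "hit_within (z + int N) n (z + int N + 1) {} = hit_within z n (z + 1) {}"
  using hit_within_periodic[of z n "z + 1" "{}"] by (simp add: algebra_simps)

lemma return_prob_periodic: "return_prob (z + int N) = return_prob z"
  using hit_within_periodic[of "z - 1" _ z "{}"] by (simp add: hit_def algebra_simps)

lemma periodic_multiple:
  assumes "\<And>z. F (z + int N) = (F z :: real)" shows "F (z + int (j * N)) = F z"
  by (induction j) (use assms[of "z + int (j * N)" for j] in \<open>auto simp: algebra_simps\<close>)

text \<open>Escape propagates to the left, and by periodicity from \<open>z\<close> to its
  translates, one of which is not below \<open>x\<close>.\<close>

lemma return_prob_all:
  assumes "return_prob z < 1" shows "return_prob x < 1"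
proof -
  define j where "j = nat \<bar>x - z\<bar>"
  have "x \<le> z + int (j * N)"
  proof -
    have "int j * 1 \<le> int j * int N" using N by (intro mult_left_mono) auto
    then show ?thesis by (simp add: j_def)
  qed
  moreover have "return_prob (z + int (j * N)) < 1"
    using periodic_multiple[of return_prob, OF return_prob_periodic] assms by simp
  ultimately show ?thesis
    using return_prob_less_left[of x "nat (z + int (j * N) - x)"] by simp
qed

lemma sum_periods:
  fixes F :: "int \<Rightarrow> real"
  assumes "\<And>z. F (z + int N) = F z"
  shows "(\<Sum>i<m * N. v i * F (int i + 1)) = (\<Sum>j<m. \<Sum>i<N. v (j * N + i) * F (int i + 1))"
proof -
  have "(\<Sum>i<m * N. v i * F (int i + 1)) = (\<Sum>j<m. \<Sum>i\<in>{j * N..<j * N + N}. v i * F (int i + 1))"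
    by (rule sum.nat_group[symmetric])
  also have "\<dots> = (\<Sum>j<m. \<Sum>i<N. v (j * N + i) * F (int (j * N + i) + 1))"
  proof (rule sum.cong)
    fix j
    show "(\<Sum>i\<in>{j * N..<j * N + N}. v i * F (int i + 1)) =
        (\<Sum>i<N. v (j * N + i) * F (int (j * N + i) + 1))"
      by (rule sum.reindex_bij_witness[of _ "\<lambda>i. j * N + i" "\<lambda>i. i - j * N"]) auto
  qed simp
  also have "\<dots> = (\<Sum>j<m. \<Sum>i<N. v (j * N + i) * F (int i + 1))"
  proof -
    have "F (int (j * N + i) + 1) = F (int i + 1)" for i j
      using periodic_multiple[of F "int i + 1" j, OF assms] by (simp add: algebra_simps)
    then show ?thesis by simp
  qed
  finally show ?thesis .
qed

section \<open>Drift collected per period\<close>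

text \<open>As the exit probabilities \<open>u\<close> are nonincreasing, division of the lower
  balance by \<open>u b\<close> bounds a sum of drift factors by \<open>b\<close>. Truncating
  returns to \<open>k\<close> steps makes these factors periodic and independent of
  \<open>b\<close>; the number of periods and then \<open>k\<close> tend to infinity.\<close>

lemma drift_le_period:
  "(\<Sum>i<N. (2 * \<omega> (int i + 1) - 1) / (1 - \<omega> (int i + 1) * return_prob (int i + 2))) \<le> real N"
proof -
  define F where "F k z = (2 * \<omega> z - 1) / (1 - \<omega> z * hit_within z k (z + 1) {})" for k z
  have pos: "0 < 1 - \<omega> z * t" if "0 \<le> t" "t \<le> 1" for z t
    using half_le[of z] less_1[of z] that by (smt (verit) mult_left_le field_sum_of_halves)
  have w: "0 \<le> 2 * \<omega> z - 1" for z using half_le[of z] by simp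
  have F0: "0 \<le> F k z" for k z
    unfolding F_def using pos[OF hit_within_bounds[of z k "z + 1" "{}"], of z] w[of z]
    by (intro divide_nonneg_nonneg) auto
  have Fper: "F k (z + int N) = F k z" for k z
    by (simp add: F_def periodic return_within_periodic)
  have *: "(\<Sum>i<N. F k (int i + 1)) \<le> real N" for k
  proof -
    define S where "S = (\<Sum>i<N. F k (int i + 1))"
    have bound: "real m * S \<le> real m * real N + (real k + 2)" for m
    proof -
      \<comment> \<open>From one site above any site of the first \<open>m\<close> periods, the end
        \<open>Suc n\<close> cannot be reached within \<open>k\<close> steps.\<close>
      define n where "n = m * N + k + 1"
      define u where "u b = 1 - hit_before 0 b 1 {}" for b
      have u0: "0 \<le> u b" for b using hit_before_bounds by (simp add: u_def)
      have "u (int (Suc n)) * (real m * S) = u (int (Suc n)) * (\<Sum>i<m * N. 1 * F k (int i + 1))"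
        using sum_periods[of "F k" "\<lambda>_. 1" m, OF Fper] by (simp add: S_def)
      also have "\<dots> = (\<Sum>i<m * N. F k (int i + 1) * u (int (Suc n)))"
        by (simp add: sum_distrib_left mult.commute)
      also have "\<dots> \<le> (\<Sum>i<m * N. (2 * \<omega> (int i + 1) - 1) * (u (int i + 1) /
          (1 - \<omega> (int i + 1) * hit_before (int i + 1) (int (Suc n)) (int i + 1 + 1) {})))"
      proof (rule sum_mono)
        fix i assume "i \<in> {..<m * N}"
        then have "i + k + 2 < Suc n" by (simp add: n_def)
        then have i: "int i + 1 + 1 + int k < int (Suc n)" by linarith
        let ?z = "int i + 1"
        let ?h = "hit_before ?z (int (Suc n)) (?z + 1) {}"
        have h: "hit_within ?z k (?z + 1) {} \<le> ?h"
          using i by (intro hit_within_le_hit_before) auto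
        have "F k ?z \<le> (2 * \<omega> ?z - 1) / (1 - \<omega> ?z * ?h)"
          unfolding F_def using h half_le[of ?z] pos[OF hit_before_bounds] w
          by (intro divide_left_mono mult_pos_pos pos diff_left_mono mult_left_mono hit_within_bounds
              hit_before_bounds) auto
        moreover have "u (int (Suc n)) \<le> u ?z"
          unfolding u_def using i by (intro diff_left_mono hit_before_mono) auto
        ultimately have "F k ?z * u (int (Suc n)) \<le> (2 * \<omega> ?z - 1) / (1 - \<omega> ?z * ?h) * u ?z"
          using F0 u0 by (intro mult_mono) (auto intro: order_trans)
        then show "F k ?z * u (int (Suc n)) \<le> (2 * \<omega> ?z - 1) * (u ?z / (1 - \<omega> ?z * ?h))"
          by simp
      qed
      also have "\<dots> \<le> (\<Sum>i<n. (2 * \<omega> (int i + 1) - 1) * (u (int i + 1) /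
          (1 - \<omega> (int i + 1) * hit_before (int i + 1) (int (Suc n)) (int i + 1 + 1) {})))"
        by (intro sum_mono2 mult_nonneg_nonneg divide_nonneg_nonneg w u0
            less_imp_le[OF pos[OF hit_before_bounds]]) (auto simp: n_def)
      also have "1 + \<dots> \<le> real (Suc n) * u (int (Suc n))"
        using balance_ge[of "int (Suc n)"] unfolding sum_interval u_def by simp
      finally have le: "1 + u (int (Suc n)) * (real m * S) \<le> real (Suc n) * u (int (Suc n))"
        by simp
      have S: "0 \<le> S" unfolding S_def by (intro sum_nonneg F0)
      \<comment> \<open>The summand 1, which stems from the starting position, keeps the exit
        probability positive.\<close>
      have "u (int (Suc n)) \<noteq> 0"
        using le by auto
      then have "0 < u (int (Suc n))" using u0[of "int (Suc n)"] by simp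
      moreover have "u (int (Suc n)) * (real m * S) \<le> u (int (Suc n)) * real (Suc n)"
        using le by (simp add: mult.commute)
      ultimately have "real m * S \<le> real (Suc n)" by (simp only: mult_le_cancel_left_pos)
      then show ?thesis by (simp add: n_def)
    qed
    \<comment> \<open>A positive excess \<open>S - real N\<close> would grow linearly in
      \<open>m\<close>, against a bound that depends on \<open>k\<close> only.\<close>
    have "(S - real N) * real m \<le> real k + 2" for m
      using bound[of m] by (simp add: algebra_simps)
    then have "\<not> 0 < S - real N"
      using reals_Archimedean3[of "S - real N"] by (metis mult.commute not_less)
    then show ?thesis by (simp add: S_def)
  qed
  have lim: "(\<lambda>k. \<Sum>i<N. F k (int i + 1)) \<longlonglongrightarrow>
    (\<Sum>i<N. (2 * \<omega> (int i + 1) - 1) / (1 - \<omega> (int i + 1) * hit (int i + 1) (int i + 1 + 1) {}))"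
    unfolding F_def using pos[OF hit_bounds]
    by (intro tendsto_intros hit_within_tendsto) (metis less_irrefl)
  show ?thesis
    using LIMSEQ_le_const2[OF lim, of "real N"] * by (simp add: ac_simps)
qed

text \<open>The exit probabilities decrease to the escape probability \<open>\<theta> > 0\<close>,
  so asymptotically they can be replaced by \<open>\<theta>\<close> in the upper balance and
  cancelled; \<open>sum_bound_limit\<close> makes this precise.\<close>

lemma period_le_drift:
  assumes "return_prob 1 < 1"
  shows "real N \<le> (\<Sum>i<N. (2 * \<omega> (int i + 1) - 1) *
    (1 + \<omega> (int i + 1) * return_prob (int i + 2) / (1 - \<omega> (int i + 1))))"
proof -
  define F where "F z = (2 * \<omega> z - 1) * (1 + \<omega> z * return_prob (z + 1) / (1 - \<omega> z))" for z
  define u where "u b = 1 - hit_before 0 b 1 {}" for b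
  define \<theta> where "\<theta> = 1 - return_prob 1"
  \<comment> \<open>The value at the first site of a period dominates those at its other sites,
    since \<open>u\<close> is nonincreasing.\<close>
  define v where "v j = u (int (j * N) + 1)" for j
  have w: "0 \<le> 2 * \<omega> z - 1" "0 < \<omega> z" "0 < 1 - \<omega> z" for z
    using half_le[of z] less_1[of z] by auto
  have F0: "0 \<le> F z" for z
    unfolding F_def using w[of z] hit_bounds
    by (intro mult_nonneg_nonneg add_nonneg_nonneg divide_nonneg_nonneg) auto
  have Fper: "F (z + int N) = F z" for z
    using return_prob_periodic[of "z + 1"] by (simp add: F_def periodic algebra_simps)
  have u0: "0 \<le> u b" for b using hit_before_bounds by (simp add: u_def)
  have \<theta>u: "\<theta> \<le> u b" if "0 < b" for b
    using hit_before_le_hit[of 0 b 1 "{}"] that by (simp add: u_def \<theta>_def)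
  have "(\<lambda>n. u (2 + int n)) \<longlonglongrightarrow> \<theta>"
    unfolding u_def \<theta>_def using hit_before_tendsto[of 0 1 "{}"] by (auto intro!: tendsto_intros)
  then have u_lim: "(\<lambda>n. u (int n)) \<longlonglongrightarrow> \<theta>"
    by (subst filterlim_sequentially_Suc[symmetric], subst filterlim_sequentially_Suc[symmetric])
       (simp add: algebra_simps)
  have "filterlim (\<lambda>j. j * N + 1) at_top sequentially"
    using N by (intro filterlim_subseq) (auto simp: strict_mono_def)
  from filterlim_compose[OF u_lim this] have v_lim: "v \<longlonglongrightarrow> \<theta>"
    by (simp add: v_def[abs_def] add.commute)
  have "real N \<le> (\<Sum>i<N. F (int i + 1))"
  proof (rule sum_bound_limit[OF v_lim])
    show "0 < \<theta>" using assms by (simp add: \<theta>_def)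
    fix m
    define n where "n = m * N"
    have "\<theta> * real N * real m \<le> real (Suc n) * \<theta>"
      using assms by (simp add: n_def \<theta>_def algebra_simps)
    also have "\<dots> \<le> real (Suc n) * u (int (Suc n))"
      by (intro mult_left_mono \<theta>u) auto
    also have "\<dots> \<le> 1 + (\<Sum>i<n. (2 * \<omega> (int i + 1) - 1) * (u (int i + 1) *
        (1 + \<omega> (int i + 1) * hit_before (int i + 1) (int (Suc n)) (int i + 1 + 1) {} /
          (1 - \<omega> (int i + 1)))))"
      using balance_le[of "int (Suc n)"] unfolding sum_interval u_def by simp
    also have "\<dots> \<le> 1 + (\<Sum>i<n. (2 * \<omega> (int i + 1) - 1) * (u (int i + 1) *
        (1 + \<omega> (int i + 1) * hit (int i + 1) (int i + 1 + 1) {} / (1 - \<omega> (int i + 1)))))"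
      using w u0
      by (intro add_left_mono sum_mono mult_left_mono divide_right_mono hit_before_le_hit)
         (auto intro: less_imp_le)
    also have "\<dots> = 1 + (\<Sum>i<m * N. u (int i + 1) * F (int i + 1))"
    proof -
      have "F z = (2 * \<omega> z - 1) * (1 + \<omega> z * hit z (z + 1) {} / (1 - \<omega> z))" for z
        by (simp add: F_def)
      then show ?thesis unfolding n_def by (simp only: mult.left_commute)
    qed
    also have "\<dots> = 1 + (\<Sum>j<m. \<Sum>i<N. u (int (j * N + i) + 1) * F (int i + 1))"
      using sum_periods[of F "\<lambda>i. u (int i + 1)" m, OF Fper] by simp
    also have "\<dots> \<le> 1 + (\<Sum>j<m. \<Sum>i<N. v j * F (int i + 1))"
      unfolding v_def u_def
      by (intro add_left_mono sum_mono mult_right_mono diff_left_mono hit_before_mono F0) auto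
    also have "\<dots> = 1 + (\<Sum>i<N. F (int i + 1)) * (\<Sum>j<m. v j)"
      by (simp add: sum_distrib_left[symmetric] sum_distrib_right[symmetric] mult.commute)
    finally show "\<theta> * real N * real m \<le> 1 + (\<Sum>i<N. F (int i + 1)) * (\<Sum>j<m. v j)" .
  qed
  then show ?thesis by (simp add: F_def add.assoc)
qed

section \<open>The threshold 2 for the mean odds\<close>

definition mean_odds :: real where
  "mean_odds = 1 / real N * (\<Sum>i<N. \<omega> (int i + 1) / (1 - \<omega> (int i + 1)))"

lemma drift_odds: "(\<Sum>i<N. (2 * \<omega> (int i + 1) - 1) / (1 - \<omega> (int i + 1))) =
    real N * (mean_odds - 1)"
proof -
  have "(2 * \<omega> z - 1) / (1 - \<omega> z) = \<omega> z / (1 - \<omega> z) - 1" for z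
    using less_1[of z] by (simp add: field_simps)
  then show ?thesis using N by (simp add: mean_odds_def sum_subtractf right_diff_distrib)
qed

text \<open>If escape is possible from one site, it is possible from all, and the upper drift bound
  lies strictly below \<open>(2 * \<omega> z - 1) / (1 - \<omega> z)\<close> where
  \<open>\<omega> z > 1/2\<close>. Summed over a period this gives
  \<open>N < N * (mean_odds - 1) \<le> N\<close>; the strictness settles the critical case.\<close>

lemma return_prob_eq_1:
  assumes "mean_odds \<le> 2" shows "return_prob z = 1"
proof (rule ccontr)
  assume "return_prob z \<noteq> 1"
  then have "return_prob z < 1" using hit_bounds(2)[of "z - 1" z "{}"] by linarith
  then have less: "return_prob x < 1" for x by (rule return_prob_all)
  let ?f = "\<lambda>z. (2 * \<omega> z - 1) * (1 + \<omega> z * return_prob (z + 1) / (1 - \<omega> z))"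
  let ?g = "\<lambda>z. (2 * \<omega> z - 1) / (1 - \<omega> z)"
  have le: "real N \<le> (\<Sum>i<N. ?f (int i + 1))"
    using period_le_drift[OF less] by (simp add: add.assoc)
  have fg: "?f z \<le> ?g z" "1/2 < \<omega> z \<Longrightarrow> ?f z < ?g z" for z
  proof -
    have w: "1/2 \<le> \<omega> z" "0 < 1 - \<omega> z" using half_le[of z] less_1[of z] by auto
    have "1 + \<omega> z * return_prob (z + 1) / (1 - \<omega> z) < 1 + \<omega> z * 1 / (1 - \<omega> z)"
      using w less[of "z + 1"] by (intro add_strict_left_mono divide_strict_right_mono mult_strict_left_mono) auto
    also have "\<dots> = 1 / (1 - \<omega> z)" using w by (simp add: field_simps)
    finally have *: "1 + \<omega> z * return_prob (z + 1) / (1 - \<omega> z) < 1 / (1 - \<omega> z)" .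
    show "?f z \<le> ?g z" using mult_left_mono[OF less_imp_le[OF *], of "2 * \<omega> z - 1"] w by simp
    show "?f z < ?g z" if "1/2 < \<omega> z"
      using mult_strict_left_mono[OF *, of "2 * \<omega> z - 1"] that by simp
  qed
  \<comment> \<open>Strict inequality needs one site with positive drift; without any, the sum would
    be 0 instead of at least \<open>N\<close>.\<close>
  have "\<exists>i<N. 1/2 < \<omega> (int i + 1)"
  proof (rule ccontr)
    assume "\<not> (\<exists>i<N. 1/2 < \<omega> (int i + 1))"
    then have "2 * \<omega> (int i + 1) - 1 = 0" if "i < N" for i
      using half_le[of "int i + 1"] that by force
    then have "(\<Sum>i<N. ?f (int i + 1)) = 0" by (intro sum.neutral) auto
    with le N show False by simp
  qed
  then have "(\<Sum>i<N. ?f (int i + 1)) < (\<Sum>i<N. ?g (int i + 1))"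
  proof (intro sum_strict_mono_ex1 ballI fg(1))
    show "\<exists>i\<in>{..<N}. ?f (int i + 1) < ?g (int i + 1)"
      if "\<exists>i<N. 1/2 < \<omega> (int i + 1)"
    proof -
      from that obtain i where i: "i < N" "1/2 < \<omega> (int i + 1)" by blast
      show ?thesis by (rule bexI[of _ i], rule fg(2)) (use i in auto)
    qed
  qed simp
  moreover have "real N * (mean_odds - 1) \<le> real N * 1"
    using assms by (intro mult_left_mono) auto
  ultimately show False using le by (simp add: drift_odds)
qed

text \<open>If every return is certain, the lower drift factors equal
  \<open>(2 * \<omega> z - 1) / (1 - \<omega> z)\<close>, and their sum over a period is at most
  \<open>N\<close>.\<close>

lemma return_prob_less_1:
  assumes "2 < mean_odds" shows "return_prob z < 1"
proof (rule ccontr)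
  assume "\<not> return_prob z < 1"
  then have "return_prob x = 1" for x
    using return_prob_all[of x z] hit_bounds(2)[of "x - 1" x "{}"] by linarith
  then have "return_prob (int i + 2) = 1" for i .
  then have "real N * (mean_odds - 1) \<le> real N * 1"
    using drift_le_period by (simp add: drift_odds)
  with N assms show False by (simp only: mult_le_cancel_left_pos of_nat_0_less_iff)
qed

lemma recurrent_if: "mean_odds \<le> 2 \<Longrightarrow> recurrent \<omega>"
  by (intro recurrentI return_prob_eq_1)

text \<open>By periodicity the return probabilities take finitely many values, so their maximum is a
  uniform bound below 1.\<close>

lemma transient_if: assumes "2 < mean_odds" shows "transient \<omega>"
proof -
  let ?S = "return_prob ` {0..<int N}"
  have "return_prob z \<in> ?S" for z
  proof -
    have "return_prob z = return_prob (z mod int N)"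
    proof (cases "0 \<le> z div int N")
      case True
      then show ?thesis
        using periodic_multiple[of return_prob "z mod int N" "nat (z div int N)", OF return_prob_periodic]
        by simp
    next
      case False
      then have "z + int (nat (- (z div int N)) * N) = z mod int N"
        by (simp add: minus_div_mult_eq_mod)
      then show ?thesis
        using periodic_multiple[of return_prob z "nat (- (z div int N))", OF return_prob_periodic]
        by simp
    qed
    then show ?thesis using N by simp
  qed
  then have "return_prob z \<le> Max ?S" for z by (intro Max_ge) auto
  moreover have "Max ?S < 1" using N return_prob_less_1[OF assms] by (subst Max_less_iff) auto
  ultimately show ?thesis by (intro transientI)
qed

end

theorem theorem1:
  fixes \<omega> :: "int \<Rightarrow> real"
  assumes "\<forall>x. 1/2 \<le> \<omega> x \<and> \<omega> x < 1"
  shows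
    "(\<forall>p. 1/2 < p \<and> p < 1 \<and> (\<forall>x. \<omega> x = p) \<longrightarrow>
        (p \<le> 2/3 \<longrightarrow> \<P>(X in cookie_law \<omega> 1. hitting_time 0 X = \<infinity>) = 0) \<and>
        (2/3 < p \<longrightarrow>
          (3 * p - 2) / p \<le> \<P>(X in cookie_law \<omega> 1. hitting_time 0 X = \<infinity>) \<and>
          \<P>(X in cookie_law \<omega> 1. hitting_time 0 X = \<infinity>) \<le> 1 / p * ((3 * p - 2) / (2 * p - 1))) \<and>
        (p \<le> 2/3 \<longrightarrow> recurrent \<omega>) \<and>
        (2/3 < p \<longrightarrow> transient \<omega>)) \<and>
     (\<forall>N::nat. 1 < N \<and> (\<forall>x. \<omega> (x + int N) = \<omega> x) \<longrightarrow>
        (1 / real N * (\<Sum>x = 1..int N. \<omega> x / (1 - \<omega> x)) \<le> 2 \<longrightarrow> recurrent \<omega>) \<and>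
        (1 / real N * (\<Sum>x = 1..int N. \<omega> x / (1 - \<omega> x)) > 2 \<longrightarrow> transient \<omega>))"
proof (intro conjI allI impI)
  fix N :: nat assume N: "1 < N \<and> (\<forall>x. \<omega> (x + int N) = \<omega> x)"
  interpret periodic_cookie_environment \<omega> N
    by unfold_locales (use assms N in auto)
  have "(\<Sum>x = 1..int N. \<omega> x / (1 - \<omega> x)) = (\<Sum>i<N. \<omega> (int i + 1) / (1 - \<omega> (int i + 1)))"
    by (rule sum.reindex_bij_witness[of _ "\<lambda>i. int i + 1" "\<lambda>x. nat (x - 1)"]) auto
  then have eq: "1 / real N * (\<Sum>x = 1..int N. \<omega> x / (1 - \<omega> x)) = mean_odds"
    by (simp add: mean_odds_def)
  show "recurrent \<omega>" if "1 / real N * (\<Sum>x = 1..int N. \<omega> x / (1 - \<omega> x)) \<le> 2"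
    using that unfolding eq by (rule recurrent_if)
  show "transient \<omega>" if "1 / real N * (\<Sum>x = 1..int N. \<omega> x / (1 - \<omega> x)) > 2"
    using that unfolding eq by (rule transient_if)
next
  fix p assume p: "1/2 < p \<and> p < 1 \<and> (\<forall>x. \<omega> x = p)"
  \<comment> \<open>With period 1 the mean odds are \<open>p / (1 - p)\<close>, which exceeds 2
    exactly if \<open>p > 2/3\<close>.\<close>
  interpret periodic_cookie_environment \<omega> 1
    by unfold_locales (use assms p in auto)
  have odds: "mean_odds = p / (1 - p)" unfolding mean_odds_def using p by simp
  have same: "return_prob z = return_prob 1" for z
  proof (cases "1 \<le> z")
    case True
    then show ?thesis
      using periodic_multiple[of return_prob 1 "nat (z - 1)", OF return_prob_periodic] by simp
  next
    case False
    then show ?thesis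
      using periodic_multiple[of return_prob z "nat (1 - z)", OF return_prob_periodic] by simp
  qed
  define \<theta> where "\<theta> = 1 - return_prob 1"
  have \<theta>: "\<P>(X in cookie_law \<omega> 1. hitting_time 0 X = \<infinity>) = \<theta>"
    unfolding measure_hitting_time_infinity \<theta>_def by simp
  have ret: "hit (1 + int i) (int i + 2) {} = 1 - \<theta>" for i
    using same[of "int i + 2"] by (simp add: \<theta>_def add.commute)
  {
    assume "p \<le> 2/3"
    then have *: "mean_odds \<le> 2" unfolding odds using p by (simp add: field_simps)
    show "\<P>(X in cookie_law \<omega> 1. hitting_time 0 X = \<infinity>) = 0"
      unfolding \<theta> \<theta>_def return_prob_eq_1[OF *] by simp
    show "recurrent \<omega>" using * by (rule recurrent_if)
  next
    assume "2/3 < p"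
    then have *: "2 < mean_odds" unfolding odds using p by (simp add: field_simps)
    show "transient \<omega>" using * by (rule transient_if)
    have \<theta>0: "0 < \<theta>" "\<theta> \<le> 1"
      using return_prob_less_1[OF *, of 1] hit_bounds[of 0 1 "{}"] by (auto simp: \<theta>_def)
    \<comment> \<open>The lower drift bound for period 1, with return probability
      \<open>1 - \<theta>\<close>; solved for \<open>\<theta>\<close> it is the lower
      estimate.\<close>
    have "(2 * p - 1) / (1 - p * (1 - \<theta>)) \<le> 1"
      using drift_le_period p same[of 2] by (simp add: \<theta>_def)
    moreover have "p * (1 - \<theta>) \<le> p * 1" using p \<theta>0 by (intro mult_left_mono) auto
    then have "0 < 1 - p * (1 - \<theta>)" using p by linarith
    ultimately show "(3 * p - 2) / p \<le> \<P>(X in cookie_law \<omega> 1. hitting_time 0 X = \<infinity>)"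
      unfolding \<theta> using p by (simp add: field_simps)
    \<comment> \<open>The upper drift bound for period 1, available since
      \<open>\<theta> > 0\<close>; it is linear in \<open>\<theta>\<close> and yields the upper
      estimate.\<close>
    have "1 \<le> (2 * p - 1) * (1 + p * (1 - \<theta>) / (1 - p))"
      using period_le_drift p same[of 2] return_prob_less_1[OF *, of 1] by (simp add: \<theta>_def)
    also have "1 + p * (1 - \<theta>) / (1 - p) = (1 - p * \<theta>) / (1 - p)"
      using p by (simp add: field_simps)
    finally have "1 - p \<le> (2 * p - 1) * (1 - p * \<theta>)"
      using p by (simp add: pos_le_divide_eq)
    then have "\<theta> * (p * (2 * p - 1)) \<le> 3 * p - 2" by (simp add: algebra_simps)
    then have "\<theta> \<le> (3 * p - 2) / (p * (2 * p - 1))"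
      using p by (subst pos_le_divide_eq) auto
    then show "\<P>(X in cookie_law \<omega> 1. hitting_time 0 X = \<infinity>) \<le>
        1 / p * ((3 * p - 2) / (2 * p - 1))"
      unfolding \<theta> by simp
  }
qed

end
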